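(* Let $0<r_1<r_2$, $\mathcal{X}=B(0,r_1)\subset\mathbb{R}^3$, $\mathcal{Y}=\mathbb{R}^3\setminus B(0,r_2)$, $\Gamma=\partial B(0,r_2)$, and $K(x,y)=1/|x-y|$. Let $X_0=\{x_1,\dots,x_n\}\subset\mathcal{X}$ be finite, $X_{\mathrm{rep}}=\{x'_1,\dots,x'_k\}\subset X_0$, and $U\in\mathbb{R}^{n\times k}$ with $i$-th row $u_i^T$; define $e_i(y)=K(x_i,y)-\sum_{j=1}^kU_{ij}K(x'_j,y)$ for $y\in\mathcal{Y}$. Let $Y_p\subset\Gamma$ be a finite nonempty set of distinct points and $c\ge0$ an integer such that for every polynomial $p$ in three variables of total degree at most $2c$, $\int_\Gamma p\,\mathrm{d}S=\frac{4\pi r_2^2}{|Y_p|}\sum_{y\in Y_p}p(y)$. Let $Y_0\subset\mathcal{Y}$ be any finite nonempty point set. Then for each $i$, $$\frac{\|e_i(Y_0)\|_2}{\sqrt{|Y_0|}}\le (c+1)\frac{\|e_i(Y_p)\|_2}{\sqrt{|Y_p|}}+(c+2)\frac{1+|X_{\mathrm{rep}}|\,\|u_i\|_\infty}{r_2-r_1}\left(\frac{r_1}{r_2}\right)^{c+1}.$$ In particular, if $\varepsilon>0$ and $\|e_i(Y_p)\|_2\le\varepsilon\sqrt{|Y_p|}$ for each $x_i\in X_0$ (i.e. the interpolative decomposition $K(X_0,Y_p)\approx UK(X_{\mathrm{rep}},Y_p)$ has precision $\varepsilon\sqrt{|Y_p|}$), then for each $i$ $$\frac{\|e_i(Y_0)\|_2}{\sqrt{|Y_0|}}\le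 (c+1)\varepsilon+(c+2)\frac{1+|X_{\mathrm{rep}}|\,\|u_i\|_\infty}{r_2-r_1}\left(\frac{r_1}{r_2}\right)^{c+1}.$$
   Context: $B(0,r)$ is the open ball of radius $r$ centered at the origin; $|S|$ is the cardinality of a finite set; $\mathrm{d}S$ is surface measure on $\Gamma$. For a finite set $Z$, $e_i(Z)=(e_i(z))_{z\in Z}$ is the vector of values of $e_i$ on $Z$; $\|u_i\|_\infty=\max_j|U_{ij}|$; $|X_{\mathrm{rep}}|=k$. $e_i(Y_0)$ is the $i$-th row of the error matrix $K(X_0,Y_0)-UK(X_{\mathrm{rep}},Y_0)$, where $K(A,B)$ is the matrix $(K(a,b))_{a\in A,b\in B}$. *)

theory Defs
  imports "HOL-Analysis.Analysis"
begin

definition poly3_deg_le :: "nat \<Rightarrow> (real^3 \<Rightarrow> real) \<Rightarrow> bool" where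
  "poly3_deg_le d p \<longleftrightarrow>
     (\<exists>a :: nat \<Rightarrow> nat \<Rightarrow> nat \<Rightarrow> real. \<forall>x.
        p x = (\<Sum>(i,j,l) \<in> {(i,j,l). i + j + l \<le> d}.
                 a i j l * (x$1)^i * (x$2)^j * (x$3)^l))"

definition sph :: "real \<Rightarrow> real \<Rightarrow> real \<Rightarrow> real^3" where
  "sph r \<theta> \<phi> = vector [r * sin \<theta> * cos \<phi>, r * sin \<theta> * sin \<phi>, r * cos \<theta>]"

text \<open>Surface integral over the sphere of radius r about 0 w.r.t. surface measure dS,
  via the standard parametrisation (surface element r^2 sin theta).\<close>
definition sphere_integral :: "real \<Rightarrow> (real^3 \<Rightarrow> real) \<Rightarrow> real" where
  "sphere_integral r f =
     integral (cbox (0,0) (pi, 2*pi))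
       (\<lambda>(\<theta>,\<phi>). f (sph r \<theta> \<phi>) * r\<^sup>2 * sin \<theta>)"

definition kernel :: "real^3 \<Rightarrow> real^3 \<Rightarrow> real" where
  "kernel x y = 1 / norm (x - y)"

definition err :: "(nat \<Rightarrow> real^3) \<Rightarrow> (nat \<Rightarrow> real^3) \<Rightarrow> nat \<Rightarrow> (nat \<Rightarrow> nat \<Rightarrow> real)
                    \<Rightarrow> nat \<Rightarrow> real^3 \<Rightarrow> real" where
  "err x xr k U i y = kernel (x i) y - (\<Sum>j<k. U i j * kernel (xr j) y)"

definition l2_on :: "(real^3 \<Rightarrow> real) \<Rightarrow> (real^3) set \<Rightarrow> real" where
  "l2_on f Z = sqrt (\<Sum>z\<in>Z. (f z)\<^sup>2)"

text \<open>Max norm of the i-th row of U (0 if k = 0).\<close>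
definition row_maxnorm :: "(nat \<Rightarrow> nat \<Rightarrow> real) \<Rightarrow> nat \<Rightarrow> nat \<Rightarrow> real" where
  "row_maxnorm U k i = Max (insert 0 ((\<lambda>j. \<bar>U i j\<bar>) ` {..<k}))"

end

theory Submission
  imports Defs
begin

text \<open>
  Expand $1/|x-y| = \sum_l |x|^l |y|^{-l-1} P_l(\hat x \cdot \hat y)$ in Legendre polynomials and
  cut $e_i$ at degree $c$. As $|P_l| \le 1$, the tail is at most
  $\frac{1 + k\|u_i\|_\infty}{r_2-r_1} (r_1/r_2)^{c+1}$ wherever $|y| \ge r_2$. On $\Gamma$ the
  truncated error is a polynomial of degree at most $c$, and by
  $\frac1{4\pi}\int_{S^2} P_l(\xi\cdot\eta) P_m(\xi\cdot\zeta)\,dS(\xi) =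
  \frac{\delta_{lm}}{2l+1} P_l(\eta\cdot\zeta)$
  its value at any $y$ with $|y| \ge r_2$ is its mean over $\Gamma$ against the kernel
  $\sum_{l\le c} (2l+1) (r_2/|y|)^{l+1} P_l(\hat\xi \cdot \hat y)$ in $\xi$, whose mean square is at most $(c+1)^2$.
  All these integrands have degree at most $2c$, so the means over $\Gamma$ are means over $Y_p$,
  and the Cauchy-Schwarz inequality for finite sums gives the factor $c+1$.

  The integral formula follows from the rotation invariance of the surface integral: it makes
  averaging over the azimuth a selfadjoint operator that does not raise the degree, on polynomials in
  $\cos\theta$, which is therefore diagonal in the Legendre basis.
\<close>

section \<open>Legendre polynomials\<close>

text \<open>Bonnet's recurrence serves as the definition because degree, endpoint values,
  orthogonality and the generating function can all be derived from it.\<close>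

fun legendre :: "nat \<Rightarrow> real poly" where
  "legendre 0 = 1"
| "legendre (Suc 0) = [:0, 1:]"
| "legendre (Suc (Suc n)) =
     smult (1 / (real n + 2))
       (smult (2 * real n + 3) ([:0, 1:] * legendre (Suc n)) - smult (real n + 1) (legendre n))"

lemma poly_legendre_rec:
  "(real n + 2) * poly (legendre (Suc (Suc n))) x =
     (2 * real n + 3) * x * poly (legendre (Suc n)) x - (real n + 1) * poly (legendre n) x"
  by simp

declare legendre.simps(3) [simp del]

lemma degree_legendre_le: "degree (legendre n) \<le> n"
proof (induction n rule: legendre.induct)
  case (3 n)
  have "degree ([:0, 1:] * legendre (Suc n)) \<le> Suc (Suc n)"
    using degree_mult_le[of "[:0, 1:]" "legendre (Suc n)"] 3(1) by simp
  then show ?case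
    using 3 by (auto simp: legendre.simps(3) intro!: degree_diff_le order.trans[OF degree_smult_le])
qed auto

text \<open>The recurrence multiplies the leading coefficient by (2n+3)/(n+2). Being nonzero, it can
  be divided by in \<open>legendre_span\<close>.\<close>

lemma coeff_legendre_pos: "coeff (legendre n) n > 0"
proof (induction n rule: legendre.induct)
  case (3 n)
  have "coeff (legendre n) (Suc (Suc n)) = 0"
    using degree_legendre_le[of n] by (intro coeff_eq_0) simp
  then show ?case using 3 by (simp add: legendre.simps(3))
qed auto

text \<open>Induction on the degree bound: a multiple of the top Legendre polynomial removes the
  leading term.\<close>

lemma legendre_span:
  assumes "degree p \<le> n"
  shows "\<exists>a. p = (\<Sum>m\<le>n. smult (a m) (legendre m))"
  using assms
proof (induction n arbitrary: p)
  case 0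
  then obtain a where "p = [:a:]" using degree_eq_zeroE by auto
  then show ?case by (auto intro!: exI[of _ "\<lambda>_. a"])
next
  case (Suc n)
  define b where "b = coeff p (Suc n) / coeff (legendre (Suc n)) (Suc n)"
  have "degree (p - smult b (legendre (Suc n))) \<le> n"
  proof (rule degree_le, intro allI impI)
    fix i assume "n < i"
    show "coeff (p - smult b (legendre (Suc n))) i = 0"
    proof (cases "i = Suc n")
      case True
      then show ?thesis using coeff_legendre_pos[of "Suc n"] by (simp add: b_def)
    next
      case False
      then show ?thesis
        using \<open>n < i\<close> Suc.prems degree_legendre_le[of "Suc n"] by (simp add: coeff_eq_0)
    qed
  qed
  then obtain a where a: "p - smult b (legendre (Suc n)) = (\<Sum>m\<le>n. smult (a m) (legendre m))"
    using Suc.IH by blast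
  have "p = (\<Sum>m\<le>Suc n. smult ((a(Suc n := b)) m) (legendre m))"
  proof -
    have "(\<Sum>m\<le>Suc n. smult ((a(Suc n := b)) m) (legendre m)) =
        (\<Sum>m\<le>n. smult (a m) (legendre m)) + smult b (legendre (Suc n))"
      by (auto intro!: sum.cong)
    then show ?thesis by (simp add: a[symmetric])
  qed
  then show ?case by blast
qed

lemma legendre_1: "poly (legendre n) 1 = 1"
proof (induction n rule: legendre.induct)
  case (3 n)
  then show ?case by (simp add: legendre.simps(3) field_simps)
qed auto

lemma legendre_minus_1: "poly (legendre n) (-1) = (-1) ^ n"
proof (induction n rule: legendre.induct)
  case (3 n)
  then show ?case by (simp add: legendre.simps(3) field_simps)
qed auto

text \<open>In this form the recurrence can be pushed through the linear maps
  \<open>legendre_ip\<close> and \<open>pderiv\<close>.\<close>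

lemma legendre_X:
  "smult (2 * real n + 3) ([:0, 1:] * legendre (Suc n)) =
     smult (real n + 2) (legendre (Suc (Suc n))) + smult (real n + 1) (legendre n)"
  by (simp add: legendre.simps(3))

section \<open>Derivatives of Legendre polynomials\<close>

lemma pderiv_legendre_rec:
  "(real n + 2) * poly (pderiv (legendre (Suc (Suc n)))) x =
     (2 * real n + 3) * (poly (legendre (Suc n)) x + x * poly (pderiv (legendre (Suc n))) x)
     - (real n + 1) * poly (pderiv (legendre n)) x"
  using arg_cong[OF legendre_X[of n], of "\<lambda>p. poly (pderiv p) x"]
  by (simp add: pderiv_smult pderiv_add pderiv_mult pderiv_pCons algebra_simps)

text \<open>The two identities are proved together because the induction step draws on both.\<close>

lemma pderiv_legendre:
  fixes x :: real
  shows "poly (pderiv (legendre (Suc n))) x =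
           x * poly (pderiv (legendre n)) x + (real n + 1) * poly (legendre n) x \<and>
         x * poly (pderiv (legendre (Suc n))) x - poly (pderiv (legendre n)) x =
           (real n + 1) * poly (legendre (Suc n)) x"
proof (induction n)
  case 0
  then show ?case by (simp add: pderiv_pCons)
next
  case (Suc n)
  define P0 where "P0 = poly (legendre n) x"
  define P1 where "P1 = poly (legendre (Suc n)) x"
  define P2 where "P2 = poly (legendre (Suc (Suc n))) x"
  define D0 where "D0 = poly (pderiv (legendre n)) x"
  define D1 where "D1 = poly (pderiv (legendre (Suc n))) x"
  define D2 where "D2 = poly (pderiv (legendre (Suc (Suc n)))) x"
  note defs = P0_def P1_def P2_def D0_def D1_def D2_def
  define N where "N = real n"
  have N: "N + 2 \<noteq> 0" "real (Suc n) = N + 1" by (simp_all add: N_def)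
  have A: "D1 = x * D0 + (N + 1) * P0"
    using conjunct1[OF Suc] unfolding defs N_def .
  have B: "x * D1 - D0 = (N + 1) * P1"
    using conjunct2[OF Suc] unfolding defs N_def .
  have R: "(N + 2) * P2 = (2 * N + 3) * x * P1 - (N + 1) * P0"
    unfolding defs N_def by (rule poly_legendre_rec)
  have DR: "(N + 2) * D2 = (2 * N + 3) * (P1 + x * D1) - (N + 1) * D0"
    unfolding defs N_def by (rule pderiv_legendre_rec)
  \<comment> \<open>Eliminating \<open>D0\<close> by \<open>B\<close> leaves the coefficient (N+2)^2
    in front of \<open>P1\<close>, so that N+2 cancels.\<close>
  have "(N + 2) * D2 = (N + 2) * (x * D1 + (N + 2) * P1)"
    using DR B by algebra
  then have A': "D2 = x * D1 + (N + 2) * P1" using N by simp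
  \<comment> \<open>Once \<open>A'\<close> and \<open>R\<close> are substituted, the claim is x
    times \<open>B\<close> minus \<open>A\<close>.\<close>
  have B': "x * D2 - D1 = (N + 2) * P2"
    unfolding R A' using A B by algebra
  from A' B' show ?case unfolding defs N by (simp add: add.commute N_def)
qed

text \<open>Subtracting the two identities at neighbouring indices removes the term x P'_{n+1}. The
  result exhibits P_{n+2} - P_n as an antiderivative of (2n+3) P_{n+1}.\<close>

lemma pderiv_legendre_diff:
  "poly (pderiv (legendre (Suc (Suc n)))) x - poly (pderiv (legendre n)) x =
     (2 * real n + 3) * poly (legendre (Suc n)) x"
  using conjunct1[OF pderiv_legendre[of "Suc n" x]] conjunct2[OF pderiv_legendre[of n x]]
  by (simp add: distrib_right)

section \<open>Orthogonality on [-1, 1]\<close>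

definition legendre_ip :: "real poly \<Rightarrow> real poly \<Rightarrow> real" where
  "legendre_ip p q = integral {-1..1} (\<lambda>s. poly p s * poly q s) / 2"

lemma legendre_ip_commute: "legendre_ip p q = legendre_ip q p"
  by (simp add: legendre_ip_def mult.commute)

lemma integrable_poly_mult:
  "(\<lambda>s. poly p s * poly q s) integrable_on {a..b}" for p q :: "real poly"
  by (intro integrable_continuous_real continuous_intros)

lemma legendre_ip_add_right: "legendre_ip p (q + r) = legendre_ip p q + legendre_ip p r"
  by (simp add: legendre_ip_def algebra_simps integral_add integrable_poly_mult add_divide_distrib)

lemma legendre_ip_smult_right: "legendre_ip p (smult a q) = a * legendre_ip p q"
  by (simp add: legendre_ip_def mult.left_commute)

lemma legendre_ip_sum_right:
  "legendre_ip p (\<Sum>i\<in>A. q i) = (\<Sum>i\<in>A. legendre_ip p (q i))"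
proof (induction A rule: infinite_finite_induct)
  case (insert x F)
  then show ?case by (simp add: legendre_ip_add_right)
qed (simp_all add: legendre_ip_def)

lemma legendre_ip_mult_X: "legendre_ip ([:0, 1:] * p) q = legendre_ip p ([:0, 1:] * q)"
  by (simp add: legendre_ip_def mult_ac)

text \<open>The antiderivative P_{n+2} - P_n vanishes at 1 and, since both indices have the same
  parity, also at -1.\<close>

lemma integral_legendre: "integral {-1..1} (poly (legendre (Suc n))) = 0"
proof -
  have "((\<lambda>x. poly (pderiv (legendre (Suc (Suc n)))) x - poly (pderiv (legendre n)) x) has_integral
      ((poly (legendre (Suc (Suc n))) 1 - poly (legendre n) 1)
       - (poly (legendre (Suc (Suc n))) (-1) - poly (legendre n) (-1)))) {-1..1}"
    by (rule fundamental_theorem_of_calculus)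
      (auto simp flip: has_real_derivative_iff_has_vector_derivative
        intro!: derivative_eq_intros poly_DERIV[THEN DERIV_subset])
  then have "((\<lambda>x. (2 * real n + 3) * poly (legendre (Suc n)) x) has_integral 0) {-1..1}"
    by (simp add: pderiv_legendre_diff legendre_1 legendre_minus_1)
  then have "integral {-1..1} (\<lambda>x. (2 * real n + 3) * poly (legendre (Suc n)) x) = 0"
    by (rule integral_unique)
  then show ?thesis by simp
qed

text \<open>Induction on m for all n at once: the recurrence lowers the left index, the factor x is
  moved to the right argument, and the recurrence there shifts n by one either way. The base cases
  rest on \<open>integral_legendre\<close>.\<close>

lemma legendre_orthogonal:
  "legendre_ip (legendre m) (legendre n) = (if m = n then 1 / (2 * real n + 1) else 0)"
proof (induction m arbitrary: n rule: legendre.induct)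
  case 1
  show ?case
  proof (cases n)
    case 0
    then show ?thesis by (simp add: legendre_ip_def)
  next
    case (Suc k)
    then show ?thesis by (simp add: legendre_ip_def integral_legendre)
  qed
next
  case 2
  show ?case
  proof (cases n)
    case 0
    then show ?thesis using integral_legendre[of 0] by (simp add: legendre_ip_def)
  next
    case (Suc k)
    have "(2 * real k + 3) * legendre_ip 1 ([:0, 1:] * legendre (Suc k)) =
        (real k + 2) * legendre_ip 1 (legendre (Suc (Suc k))) + (real k + 1) * legendre_ip 1 (legendre k)"
      by (simp only: legendre_X legendre_ip_add_right legendre_ip_smult_right
          flip: legendre_ip_smult_right[of _ "2 * real k + 3"])
    moreover have "legendre_ip 1 (legendre (Suc (Suc k))) = 0"
      by (simp add: legendre_ip_def integral_legendre)
    moreover have "legendre_ip 1 (legendre k) = (if k = 0 then 1 else 0)"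
      by (cases k) (simp_all add: legendre_ip_def integral_legendre)
    ultimately have "(2 * real k + 3) * legendre_ip 1 ([:0, 1:] * legendre n) = (if k = 0 then 1 else 0)"
      by (simp add: Suc del: mult_pCons_left)
    moreover have "legendre_ip (legendre (Suc 0)) (legendre n) = legendre_ip 1 ([:0, 1:] * legendre n)"
      using legendre_ip_mult_X[of 1 "legendre n"] by simp
    ultimately show ?thesis using Suc by (auto split: if_splits)
  qed
next
  case (3 m)
  note IH0 = 3(2) and IH1 = 3(1)
  have main: "(real m + 2) * legendre_ip (legendre (Suc (Suc m))) (legendre n) =
      (2 * real m + 3) * legendre_ip (legendre (Suc m)) ([:0, 1:] * legendre n)
      - (real m + 1) * legendre_ip (legendre m) (legendre n)"
  proof -
    have "(2 * real m + 3) * legendre_ip (legendre n) ([:0, 1:] * legendre (Suc m)) =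
      (real m + 2) * legendre_ip (legendre n) (legendre (Suc (Suc m))) + (real m + 1) * legendre_ip (legendre n) (legendre m)"
      by (simp only: legendre_X legendre_ip_add_right legendre_ip_smult_right flip: legendre_ip_smult_right[of _ "2 * real m + 3"])
    then show ?thesis
      by (simp add: legendre_ip_commute[of _ "legendre n"] legendre_ip_mult_X legendre_ip_commute[of "[:0, 1:] * legendre n"]
          del: mult_pCons_left)
         (metis legendre_ip_commute legendre_ip_mult_X add_diff_cancel_right')
  qed
  show ?case
  proof (cases n)
    case 0
    have "legendre_ip (legendre (Suc (Suc m))) (legendre 0) = 0"
      by (simp add: legendre_ip_def integral_legendre)
    then show ?thesis using 0 by simp
  next
    case (Suc k)
    have "(2 * real k + 3) * legendre_ip (legendre (Suc m)) ([:0, 1:] * legendre (Suc k)) =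
      (real k + 2) * legendre_ip (legendre (Suc m)) (legendre (Suc (Suc k))) + (real k + 1) * legendre_ip (legendre (Suc m)) (legendre k)"
      by (simp only: legendre_X legendre_ip_add_right legendre_ip_smult_right flip: legendre_ip_smult_right[of _ "2 * real k + 3"])
    then have X: "legendre_ip (legendre (Suc m)) ([:0, 1:] * legendre (Suc k)) =
      ((real k + 2) * (if m = Suc k then 1 / (2 * real k + 5) else 0)
       + (real k + 1) * (if Suc m = k then 1 / (2 * real k + 1) else 0)) / (2 * real k + 3)"
      unfolding IH1 by (simp add: field_simps)
    have "(real m + 2) * legendre_ip (legendre (Suc (Suc m))) (legendre (Suc k)) =
      (real m + 2) * (if Suc m = k then 1 / (2 * real k + 3) else 0)"
    proof -
      \<comment> \<open>In the first case both terms of \<open>main\<close> survive and cancel. In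
        the second only the term with equal indices survives and gives the squared norm. In the
        third everything vanishes.\<close>
      consider "m = Suc k" | "Suc m = k" | "m \<noteq> Suc k" "Suc m \<noteq> k" by blast
      then show ?thesis
      proof cases
        case 1
        then have m: "2 * real m + 3 = 2 * real k + 5" by simp
        have "(2 * real m + 3) * ((real k + 2) * (1 / (2 * real k + 5)) / (2 * real k + 3)) =
            (real k + 2) / (2 * real k + 3)"
          unfolding m by simp
        then show ?thesis using 1 unfolding main[unfolded Suc] X IH0 by (simp add: add.commute)
      next
        case 2
        then have m: "2 * real m + 3 = 2 * real k + 1" "real m + 2 = real k + 1" by auto
        have "2 * real k + 1 \<noteq> 0" using of_nat_0_le_iff[of k, where 'a = real] by linarith
        then have "(2 * real m + 3) * ((real k + 1) * (1 / (2 * real k + 1)) / (2 * real k + 3)) =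
            (real m + 2) * (1 / (2 * real k + 3))"
          unfolding m by simp
        then show ?thesis using 2 unfolding main[unfolded Suc] X IH0 by auto
      next
        case 3
        then show ?thesis unfolding main[unfolded Suc] X IH0 by auto
      qed
    qed
    then have "legendre_ip (legendre (Suc (Suc m))) (legendre (Suc k)) =
      (if Suc m = k then 1 / (2 * real k + 3) else 0)"
      by (rule mult_left_cancel[THEN iffD1, rotated]) linarith
    then show ?thesis unfolding Suc by simp
  qed
qed

section \<open>Rotation invariance of the surface integral\<close>

definition lin_sph :: "real \<Rightarrow> real \<Rightarrow> real \<Rightarrow> real \<Rightarrow> real \<Rightarrow> real" where
  "lin_sph a1 a2 a3 \<theta> \<phi> = a1 * (sin \<theta> * cos \<phi>) + a2 * (sin \<theta> * sin \<phi>) + a3 * cos \<theta>"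

lemma sph_inner: "sph 1 \<theta> \<phi> \<bullet> \<eta> = lin_sph (\<eta>$1) (\<eta>$2) (\<eta>$3) \<theta> \<phi>"
  by (simp add: sph_def lin_sph_def inner_vec_def sum_3 mult_ac)

text \<open>Only products of two zonal functions are ever integrated, so a rotation of the sphere
  can be expressed by rotating the two axes and leaving the integrand's form unchanged.\<close>

definition pair_integral :: "real poly \<Rightarrow> real poly \<Rightarrow> real^3 \<Rightarrow> real^3 \<Rightarrow> real" where
  "pair_integral f g \<eta> \<zeta> = sphere_integral 1 (\<lambda>\<xi>. poly f (\<xi> \<bullet> \<eta>) * poly g (\<xi> \<bullet> \<zeta>))"

lemma continuous_on_lin_sph [continuous_intros]:
  fixes A :: "'a::t2_space set"
  assumes "continuous_on A a1" "continuous_on A a2" "continuous_on A a3"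
    "continuous_on A t" "continuous_on A p"
  shows "continuous_on A (\<lambda>x. lin_sph (a1 x) (a2 x) (a3 x) (t x) (p x))"
  unfolding lin_sph_def by (intro continuous_intros assms)

lemma pair_integral_eq:
  "pair_integral f g \<eta> \<zeta> = integral (cbox (0,0) (pi, 2*pi)) (\<lambda>(\<theta>,\<phi>).
     poly f (lin_sph (\<eta>$1) (\<eta>$2) (\<eta>$3) \<theta> \<phi>) * poly g (lin_sph (\<zeta>$1) (\<zeta>$2) (\<zeta>$3) \<theta> \<phi>) * sin \<theta>)"
  unfolding pair_integral_def sphere_integral_def by (simp add: sph_inner)

text \<open>By Fubini the first summand is integrated over theta first and the second over phi
  first; each inner integral is a difference of equal boundary values.\<close>

lemma integral_divergence_zero:
  fixes A B A' B' :: "real \<Rightarrow> real \<Rightarrow> real"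
  assumes A: "\<And>\<theta> \<phi>. ((\<lambda>\<theta>. A \<theta> \<phi>) has_real_derivative A' \<theta> \<phi>) (at \<theta>)"
    and B: "\<And>\<theta> \<phi>. ((\<lambda>\<phi>. B \<theta> \<phi>) has_real_derivative B' \<theta> \<phi>) (at \<phi>)"
    and cont: "continuous_on UNIV (\<lambda>(\<theta>,\<phi>). A' \<theta> \<phi>)" "continuous_on UNIV (\<lambda>(\<theta>,\<phi>). B' \<theta> \<phi>)"
    and boundary: "\<And>\<phi>. A a \<phi> = A b \<phi>" "\<And>\<theta>. B \<theta> c = B \<theta> d"
    and le: "a \<le> b" "c \<le> d"
  shows "integral (cbox (a,c) (b,d)) (\<lambda>(\<theta>,\<phi>). A' \<theta> \<phi> + B' \<theta> \<phi>) = 0"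
proof -
  have cA: "continuous_on (cbox (a,c) (b,d)) (\<lambda>(\<theta>,\<phi>). A' \<theta> \<phi>)"
    and cB: "continuous_on (cbox (a,c) (b,d)) (\<lambda>(\<theta>,\<phi>). B' \<theta> \<phi>)"
    using cont continuous_on_subset by blast+
  have iA: "integral (cbox a b) (\<lambda>\<theta>. A' \<theta> \<phi>) = 0" for \<phi>
  proof -
    have "((\<lambda>\<theta>. A' \<theta> \<phi>) has_integral (A b \<phi> - A a \<phi>)) {a..b}"
      by (rule fundamental_theorem_of_calculus[OF le(1)])
        (use A in \<open>auto simp flip: has_real_derivative_iff_has_vector_derivative
          intro: has_field_derivative_at_within\<close>)
    then show ?thesis using boundary by (simp add: integral_unique)
  qed
  have iB: "integral (cbox c d) (\<lambda>\<phi>. B' \<theta> \<phi>) = 0" for \<theta>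
  proof -
    have "((\<lambda>\<phi>. B' \<theta> \<phi>) has_integral (B \<theta> d - B \<theta> c)) {c..d}"
      by (rule fundamental_theorem_of_calculus[OF le(2)])
        (use B in \<open>auto simp flip: has_real_derivative_iff_has_vector_derivative
          intro: has_field_derivative_at_within\<close>)
    then show ?thesis using boundary by (simp add: integral_unique)
  qed
  have "integral (cbox (a,c) (b,d)) (\<lambda>(\<theta>,\<phi>). A' \<theta> \<phi>) = 0"
    using integral_prod_continuous[OF cA] integral_swap_continuous[OF cA] by (simp add: iA del: box_real)
  moreover have "integral (cbox (a,c) (b,d)) (\<lambda>(\<theta>,\<phi>). B' \<theta> \<phi>) = 0"
    using integral_prod_continuous[OF cB] by (simp add: iB del: box_real)
  moreover have "integral (cbox (a,c) (b,d)) (\<lambda>(\<theta>,\<phi>). A' \<theta> \<phi> + B' \<theta> \<phi>) =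
      integral (cbox (a,c) (b,d)) (\<lambda>(\<theta>,\<phi>). A' \<theta> \<phi>) + integral (cbox (a,c) (b,d)) (\<lambda>(\<theta>,\<phi>). B' \<theta> \<phi>)"
    using integral_add[OF integrable_continuous[OF cA] integrable_continuous[OF cB]]
    by (simp add: case_prod_unfold)
  ultimately show ?thesis by simp
qed

text \<open>Rotations about two coordinate axes suffice: by Euler angles they bring any pair of unit
  vectors into a standard position, see \<open>pair_integral_eq_meridian\<close>.\<close>

definition rot_y :: "real \<Rightarrow> real^3 \<Rightarrow> real^3" where
  "rot_y \<beta> v = vector [v$1 * cos \<beta> + v$3 * sin \<beta>, v$2, v$3 * cos \<beta> - v$1 * sin \<beta>]"

definition rot_z :: "real \<Rightarrow> real^3 \<Rightarrow> real^3" where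
  "rot_z \<beta> v = vector [v$1 * cos \<beta> - v$2 * sin \<beta>, v$1 * sin \<beta> + v$2 * cos \<beta>, v$3]"

lemma rot_nth [simp]:
  "rot_y \<beta> v $ 1 = v$1 * cos \<beta> + v$3 * sin \<beta>" "rot_y \<beta> v $ 2 = v$2"
  "rot_y \<beta> v $ 3 = v$3 * cos \<beta> - v$1 * sin \<beta>"
  "rot_z \<beta> v $ 1 = v$1 * cos \<beta> - v$2 * sin \<beta>" "rot_z \<beta> v $ 2 = v$1 * sin \<beta> + v$2 * cos \<beta>"
  "rot_z \<beta> v $ 3 = v$3"
  by (simp_all add: rot_y_def rot_z_def)

text \<open>Differentiation under the integral sign reduces invariance under a one-parameter group
  to its infinitesimal version.\<close>

lemma constant_if_derivative_integrates_to_zero: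
  fixes F F' :: "real \<Rightarrow> real \<times> real \<Rightarrow> real"
  assumes "\<And>\<beta> t. ((\<lambda>\<beta>. F \<beta> t) has_real_derivative F' \<beta> t) (at \<beta>)"
    and "\<And>\<beta>. continuous_on UNIV (F \<beta>)"
    and "continuous_on UNIV (\<lambda>(\<beta>, t). F' \<beta> t)"
    and "\<And>\<beta>. integral (cbox a b) (F' \<beta>) = 0"
  shows "integral (cbox a b) (F \<beta>) = integral (cbox a b) (F 0)"
proof -
  have "((\<lambda>\<beta>. integral (cbox a b) (F \<beta>)) has_field_derivative integral (cbox a b) (F' x)) (at x within UNIV)"
    for x
    by (rule leibniz_rule_field_derivative)
      (use assms(1,3) in \<open>auto intro!: integrable_continuous continuous_on_subset[OF assms(2)]
        intro: continuous_on_subset\<close>)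
  then have "\<forall>x. ((\<lambda>\<beta>. integral (cbox a b) (F \<beta>)) has_field_derivative 0) (at x)"
    using assms(4) by simp
  then show ?thesis using DERIV_isconst_all by blast
qed

text \<open>The generator of the rotations about the $y$-axis is
  $X = \cos\phi\,\partial_\theta - \cot\theta\sin\phi\,\partial_\phi$, and
  $\sin\theta\, X F = \partial_\theta(\sin\theta\cos\phi\, F) - \partial_\phi(\cos\theta\sin\phi\, F)$
  is a divergence without flux through the boundary of the parameter rectangle.\<close>

lemma pair_integral_rot_y: "pair_integral f g (rot_y \<beta> \<eta>) (rot_y \<beta> \<zeta>) = pair_integral f g \<eta> \<zeta>"
proof -
  define u where "u \<beta> = lin_sph (rot_y \<beta> \<eta> $ 1) (rot_y \<beta> \<eta> $ 2) (rot_y \<beta> \<eta> $ 3)" for \<beta>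
  define v where "v \<beta> = lin_sph (rot_y \<beta> \<zeta> $ 1) (rot_y \<beta> \<zeta> $ 2) (rot_y \<beta> \<zeta> $ 3)" for \<beta>
  define du where "du \<beta> \<theta> \<phi> = rot_y \<beta> \<eta> $ 3 * (sin \<theta> * cos \<phi>) - rot_y \<beta> \<eta> $ 1 * cos \<theta>" for \<beta> \<theta> \<phi>
  define dv where "dv \<beta> \<theta> \<phi> = rot_y \<beta> \<zeta> $ 3 * (sin \<theta> * cos \<phi>) - rot_y \<beta> \<zeta> $ 1 * cos \<theta>" for \<beta> \<theta> \<phi>
  \<comment> \<open>The shift by pi/2 turns sin theta into cos theta, so this is the
    theta-derivative of \<open>u\<close>; the third coordinate has its derivative written
    separately.\<close>
  define ut where "ut \<beta> \<theta> \<phi> = lin_sph (rot_y \<beta> \<eta> $ 1) (rot_y \<beta> \<eta> $ 2) 0 (\<theta> + pi/2) \<phi> - rot_y \<beta> \<eta> $ 3 * sin \<theta>" for \<beta> \<theta> \<phi>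
  define vt where "vt \<beta> \<theta> \<phi> = lin_sph (rot_y \<beta> \<zeta> $ 1) (rot_y \<beta> \<zeta> $ 2) 0 (\<theta> + pi/2) \<phi> - rot_y \<beta> \<zeta> $ 3 * sin \<theta>" for \<beta> \<theta> \<phi>
  define up where "up \<beta> \<theta> \<phi> = sin \<theta> * (rot_y \<beta> \<eta> $ 2 * cos \<phi> - rot_y \<beta> \<eta> $ 1 * sin \<phi>)" for \<beta> \<theta> \<phi>
  define vp where "vp \<beta> \<theta> \<phi> = sin \<theta> * (rot_y \<beta> \<zeta> $ 2 * cos \<phi> - rot_y \<beta> \<zeta> $ 1 * sin \<phi>)" for \<beta> \<theta> \<phi>
  note defs = u_def v_def du_def dv_def ut_def vt_def up_def vp_def lin_sph_def
  define H where "H \<beta> \<theta> \<phi> = poly f (u \<beta> \<theta> \<phi>) * poly g (v \<beta> \<theta> \<phi>)" for \<beta> \<theta> \<phi>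
  \<comment> \<open>The slots \<open>a\<close> and \<open>b\<close> take the derivatives of
    \<open>u\<close> and \<open>v\<close>, so one product rule serves all three variables.\<close>
  define DH where "DH a b \<beta> \<theta> \<phi> = poly (pderiv f) (u \<beta> \<theta> \<phi>) * a * poly g (v \<beta> \<theta> \<phi>)
    + poly f (u \<beta> \<theta> \<phi>) * (poly (pderiv g) (v \<beta> \<theta> \<phi>) * b)" for a b \<beta> \<theta> \<phi>
  have u: "((\<lambda>\<beta>. u \<beta> \<theta> \<phi>) has_real_derivative du \<beta> \<theta> \<phi>) (at \<beta>)"
    "((\<lambda>\<theta>. u \<beta> \<theta> \<phi>) has_real_derivative ut \<beta> \<theta> \<phi>) (at \<theta>)"
    "((\<lambda>\<phi>. u \<beta> \<theta> \<phi>) has_real_derivative up \<beta> \<theta> \<phi>) (at \<phi>)"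
    "((\<lambda>\<beta>. v \<beta> \<theta> \<phi>) has_real_derivative dv \<beta> \<theta> \<phi>) (at \<beta>)"
    "((\<lambda>\<theta>. v \<beta> \<theta> \<phi>) has_real_derivative vt \<beta> \<theta> \<phi>) (at \<theta>)"
    "((\<lambda>\<phi>. v \<beta> \<theta> \<phi>) has_real_derivative vp \<beta> \<theta> \<phi>) (at \<phi>)" for \<beta> \<theta> \<phi>
    unfolding defs
    by (auto intro!: derivative_eq_intros simp: sin_add cos_add algebra_simps)
  have H: "((\<lambda>\<beta>. H \<beta> \<theta> \<phi>) has_real_derivative DH (du \<beta> \<theta> \<phi>) (dv \<beta> \<theta> \<phi>) \<beta> \<theta> \<phi>) (at \<beta>)"
    "((\<lambda>\<theta>. H \<beta> \<theta> \<phi>) has_real_derivative DH (ut \<beta> \<theta> \<phi>) (vt \<beta> \<theta> \<phi>) \<beta> \<theta> \<phi>) (at \<theta>)"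
    "((\<lambda>\<phi>. H \<beta> \<theta> \<phi>) has_real_derivative DH (up \<beta> \<theta> \<phi>) (vp \<beta> \<theta> \<phi>) \<beta> \<theta> \<phi>) (at \<phi>)" for \<beta> \<theta> \<phi>
    unfolding H_def DH_def
    by (auto intro!: derivative_eq_intros u DERIV_chain2[OF poly_DERIV] simp: algebra_simps)
  have zero: "integral (cbox (0,0) (pi, 2*pi)) (\<lambda>(\<theta>,\<phi>). DH (du \<beta> \<theta> \<phi>) (dv \<beta> \<theta> \<phi>) \<beta> \<theta> \<phi> * sin \<theta>) = 0" for \<beta>
  proof -
    have alg: "DH (du \<beta> \<theta> \<phi>) (dv \<beta> \<theta> \<phi>) \<beta> \<theta> \<phi> * sin \<theta> =
        (- (cos \<theta> * cos \<phi> * H \<beta> \<theta> \<phi> + sin \<theta> * cos \<phi> * DH (ut \<beta> \<theta> \<phi>) (vt \<beta> \<theta> \<phi>) \<beta> \<theta> \<phi>))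
        + (cos \<theta> * cos \<phi> * H \<beta> \<theta> \<phi> + cos \<theta> * sin \<phi> * DH (up \<beta> \<theta> \<phi>) (vp \<beta> \<theta> \<phi>) \<beta> \<theta> \<phi>)" for \<theta> \<phi>
    proof -
      \<comment> \<open>On \<open>u\<close> and \<open>v\<close> the derivative in the rotation
        angle is -X, here multiplied by sin theta to clear the singularity of X at the
        poles.\<close>
      have "du \<beta> \<theta> \<phi> * sin \<theta> = cos \<theta> * sin \<phi> * up \<beta> \<theta> \<phi> - sin \<theta> * cos \<phi> * ut \<beta> \<theta> \<phi>"
        "dv \<beta> \<theta> \<phi> * sin \<theta> = cos \<theta> * sin \<phi> * vp \<beta> \<theta> \<phi> - sin \<theta> * cos \<phi> * vt \<beta> \<theta> \<phi>"
        unfolding defs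
        by (simp_all add: sin_add cos_add) (use sin_cos_squared_add[of \<phi>] in algebra)+
      then show ?thesis unfolding DH_def by algebra
    qed
    show ?thesis
      unfolding alg
      by (rule integral_divergence_zero[where A = "\<lambda>\<theta> \<phi>. - (sin \<theta> * cos \<phi> * H \<beta> \<theta> \<phi>)"
            and B = "\<lambda>\<theta> \<phi>. cos \<theta> * sin \<phi> * H \<beta> \<theta> \<phi>"])
        (auto intro!: derivative_eq_intros H simp: algebra_simps,
         auto simp: case_prod_unfold H_def DH_def defs intro!: continuous_intros)
  qed
  have "integral (cbox (0,0) (pi, 2*pi)) (\<lambda>(\<theta>,\<phi>). H \<beta> \<theta> \<phi> * sin \<theta>) =
      integral (cbox (0,0) (pi, 2*pi)) (\<lambda>(\<theta>,\<phi>). H 0 \<theta> \<phi> * sin \<theta>)"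
    by (rule constant_if_derivative_integrates_to_zero[OF _ _ _ zero])
      (auto intro!: derivative_eq_intros H simp: case_prod_unfold,
       auto simp: case_prod_unfold H_def DH_def defs intro!: continuous_intros)
  then show ?thesis by (simp add: pair_integral_eq H_def u_def v_def)
qed

text \<open>The derivative in the rotation angle is minus the phi-derivative, so the flux is purely
  azimuthal and cancels by 2 pi periodicity.\<close>

lemma pair_integral_rot_z: "pair_integral f g (rot_z \<beta> \<eta>) (rot_z \<beta> \<zeta>) = pair_integral f g \<eta> \<zeta>"
proof -
  define u where "u \<beta> = lin_sph (rot_z \<beta> \<eta> $ 1) (rot_z \<beta> \<eta> $ 2) (rot_z \<beta> \<eta> $ 3)" for \<beta>
  define v where "v \<beta> = lin_sph (rot_z \<beta> \<zeta> $ 1) (rot_z \<beta> \<zeta> $ 2) (rot_z \<beta> \<zeta> $ 3)" for \<beta>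
  define up where "up \<beta> \<theta> \<phi> = sin \<theta> * (rot_z \<beta> \<eta> $ 2 * cos \<phi> - rot_z \<beta> \<eta> $ 1 * sin \<phi>)" for \<beta> \<theta> \<phi>
  define vp where "vp \<beta> \<theta> \<phi> = sin \<theta> * (rot_z \<beta> \<zeta> $ 2 * cos \<phi> - rot_z \<beta> \<zeta> $ 1 * sin \<phi>)" for \<beta> \<theta> \<phi>
  note defs = u_def v_def up_def vp_def lin_sph_def
  define H where "H \<beta> \<theta> \<phi> = poly f (u \<beta> \<theta> \<phi>) * poly g (v \<beta> \<theta> \<phi>)" for \<beta> \<theta> \<phi>
  define DH where "DH \<beta> \<theta> \<phi> = poly (pderiv f) (u \<beta> \<theta> \<phi>) * up \<beta> \<theta> \<phi> * poly g (v \<beta> \<theta> \<phi>)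
    + poly f (u \<beta> \<theta> \<phi>) * (poly (pderiv g) (v \<beta> \<theta> \<phi>) * vp \<beta> \<theta> \<phi>)" for \<beta> \<theta> \<phi>
  have u: "((\<lambda>\<beta>. u \<beta> \<theta> \<phi>) has_real_derivative - up \<beta> \<theta> \<phi>) (at \<beta>)"
    "((\<lambda>\<phi>. u \<beta> \<theta> \<phi>) has_real_derivative up \<beta> \<theta> \<phi>) (at \<phi>)"
    "((\<lambda>\<beta>. v \<beta> \<theta> \<phi>) has_real_derivative - vp \<beta> \<theta> \<phi>) (at \<beta>)"
    "((\<lambda>\<phi>. v \<beta> \<theta> \<phi>) has_real_derivative vp \<beta> \<theta> \<phi>) (at \<phi>)" for \<beta> \<theta> \<phi>
    unfolding defs
    by (auto intro!: derivative_eq_intros simp: algebra_simps)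
  have H: "((\<lambda>\<beta>. H \<beta> \<theta> \<phi>) has_real_derivative - DH \<beta> \<theta> \<phi>) (at \<beta>)"
    "((\<lambda>\<phi>. H \<beta> \<theta> \<phi>) has_real_derivative DH \<beta> \<theta> \<phi>) (at \<phi>)" for \<beta> \<theta> \<phi>
    unfolding H_def DH_def
    by (auto intro!: derivative_eq_intros u DERIV_chain2[OF poly_DERIV] simp: algebra_simps)
  \<comment> \<open>The summand 0 keeps the integrand in divergence form, with no
    theta-component.\<close>
  have zero: "integral (cbox (0,0) (pi, 2*pi)) (\<lambda>(\<theta>,\<phi>). 0 + - DH \<beta> \<theta> \<phi> * sin \<theta>) = 0" for \<beta>
    by (rule integral_divergence_zero[where A = "\<lambda>\<theta> \<phi>. 0" and B = "\<lambda>\<theta> \<phi>. - H \<beta> \<theta> \<phi> * sin \<theta>"])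
      (auto intro!: derivative_eq_intros H simp: algebra_simps,
       auto simp: case_prod_unfold H_def DH_def defs intro!: continuous_intros)
  have "integral (cbox (0,0) (pi, 2*pi)) (\<lambda>(\<theta>,\<phi>). H \<beta> \<theta> \<phi> * sin \<theta>) =
      integral (cbox (0,0) (pi, 2*pi)) (\<lambda>(\<theta>,\<phi>). H 0 \<theta> \<phi> * sin \<theta>)"
    by (rule constant_if_derivative_integrates_to_zero[OF _ _ _ zero])
      (auto intro!: derivative_eq_intros H simp: case_prod_unfold,
       auto simp: case_prod_unfold H_def DH_def defs intro!: continuous_intros)
  then show ?thesis by (simp add: pair_integral_eq H_def u_def v_def)
qed

section \<open>Averaging over the azimuth\<close>

text \<open>By the spherical law of cosines the argument of \<open>f\<close> is the cosine of the
  angle between points of colatitudes theta and alpha whose longitudes differ by phi.\<close>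

definition azimuthal_mean :: "(real \<Rightarrow> real) \<Rightarrow> real \<Rightarrow> real \<Rightarrow> real" where
  "azimuthal_mean f \<alpha> \<theta> =
     integral {0..2*pi} (\<lambda>\<phi>. f (cos \<theta> * cos \<alpha> + sin \<theta> * sin \<alpha> * cos \<phi>)) / (2 * pi)"

text \<open>Wallis' recursion, obtained by integrating the derivative of cos^(j+1) sin over a
  period, descends to the exponent 1.\<close>

lemma integral_cos_power_odd:
  assumes "odd j"
  shows "integral {0..2*pi} (\<lambda>\<phi>. cos \<phi> ^ j) = 0"
proof -
  have FTC: "integral {0..2*pi} (\<lambda>\<phi>. (real j + 2) * cos \<phi> ^ (j + 2) - (real j + 1) * cos \<phi> ^ j) = 0" for j
  proof -
    have "((\<lambda>\<phi>. (real j + 2) * cos \<phi> ^ (j + 2) - (real j + 1) * cos \<phi> ^ j) has_integral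
        (cos (2*pi) ^ (j+1) * sin (2*pi) - cos 0 ^ (j+1) * sin 0)) {0..2*pi}"
    proof (rule fundamental_theorem_of_calculus)
      fix x :: real
      have sq: "sin x * sin x = 1 - cos x * cos x"
        using sin_squared_eq[of x] by (simp add: power2_eq_square)
      have "((\<lambda>x. cos x ^ (j+1) * sin x) has_real_derivative
          real (j+1) * cos x ^ j * (- sin x) * sin x + cos x ^ (j+1) * cos x) (at x)"
        using DERIV_mult[OF DERIV_power_Suc[OF DERIV_cos[of x], of j] DERIV_sin[of x]]
        by (simp add: algebra_simps)
      moreover have "real (j+1) * cos x ^ j * (- sin x) * sin x = - (real (j+1) * cos x ^ j * (1 - cos x * cos x))"
        unfolding sq[symmetric] by simp
      ultimately show "((\<lambda>x. cos x ^ (j+1) * sin x) has_vector_derivative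
          (real j + 2) * cos x ^ (j + 2) - (real j + 1) * cos x ^ j) (at x within {0..2*pi})"
        by (auto simp flip: has_real_derivative_iff_has_vector_derivative
            simp: algebra_simps intro: has_field_derivative_at_within)
    qed simp
    then show ?thesis by (simp add: integral_unique)
  qed
  have rec: "(real j + 2) * integral {0..2*pi} (\<lambda>\<phi>. cos \<phi> ^ (j + 2)) =
      (real j + 1) * integral {0..2*pi} (\<lambda>\<phi>. cos \<phi> ^ j)" for j
    using FTC[of j]
    by (subst (asm) integral_diff) (auto intro!: integrable_continuous_real continuous_intros)
  obtain i where "j = 2 * i + 1" using assms by (auto elim: oddE)
  moreover have "integral {0..2*pi} (\<lambda>\<phi>. cos \<phi> ^ (2 * i + 1)) = 0"
  proof (induction i)
    case 0
    have "(cos has_integral (sin (2*pi) - sin 0)) {0..2*pi}"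
      by (rule fundamental_theorem_of_calculus)
        (auto simp flip: has_real_derivative_iff_has_vector_derivative intro!: derivative_eq_intros)
    then show ?case by (simp add: integral_unique)
  next
    case (Suc i)
    have "(real (2*i+1) + 2) * integral {0..2*pi} (\<lambda>\<phi>. cos \<phi> ^ (2 * Suc i + 1)) = 0"
      using rec[of "2*i+1"] unfolding Suc.IH by (simp add: eval_nat_numeral)
    moreover have "real (2*i+1) + 2 \<noteq> 0" by simp
    ultimately show ?case by (metis mult_eq_0_iff)
  qed
  ultimately show ?thesis by simp
qed

text \<open>In the binomial expansion odd powers of cos phi average to zero, and the even powers
  that remain come with even powers of sin theta, which are polynomials in cos theta of the same
  degree.\<close>

lemma azimuthal_mean_power:
  "\<exists>q. degree q \<le> m \<and> (\<forall>\<theta>. poly q (cos \<theta>) = azimuthal_mean (\<lambda>s. s ^ m) \<alpha> \<theta>)"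
proof -
  define w where "w j = integral {0..2*pi} (\<lambda>\<phi>. cos \<phi> ^ j) / (2 * pi)" for j :: nat
  \<comment> \<open>The factor \<open>[:1, 0, -1:]\<close> stands for sin^2 theta as 1 - x^2.
    Rounding in \<open>j div 2\<close> is harmless, since \<open>w j\<close> is 0 for odd j.\<close>
  define q where "q = (\<Sum>j\<le>m. smult (real (m choose j) * w j * cos \<alpha> ^ (m - j) * sin \<alpha> ^ j)
    ([:1, 0, -1:] ^ (j div 2) * monom 1 (m - j)))"
  have "degree q \<le> m"
    unfolding q_def
  proof (intro degree_sum_le)
    fix j assume "j \<in> {..m}"
    have "degree ([:1, 0, -1:] ^ (j div 2) * monom 1 (m - j) :: real poly) \<le> 2 * (j div 2) + (m - j)"
      by (intro order.trans[OF degree_mult_le] add_mono order.trans[OF degree_power_le] degree_monom_le) auto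
    also have "\<dots> \<le> m" using \<open>j \<in> {..m}\<close> by auto
    finally show "degree (smult (real (m choose j) * w j * cos \<alpha> ^ (m - j) * sin \<alpha> ^ j)
        ([:1, 0, -1:] ^ (j div 2) * monom 1 (m - j))) \<le> m"
      using degree_smult_le order.trans by blast
  qed auto
  moreover have "poly q (cos \<theta>) = azimuthal_mean (\<lambda>s. s ^ m) \<alpha> \<theta>" for \<theta>
  proof -
    have "azimuthal_mean (\<lambda>s. s ^ m) \<alpha> \<theta> = integral {0..2*pi} (\<lambda>\<phi>. \<Sum>j\<le>m.
        (real (m choose j) * (sin \<theta> * sin \<alpha>) ^ j * (cos \<theta> * cos \<alpha>) ^ (m - j)) * cos \<phi> ^ j) / (2 * pi)"
      unfolding azimuthal_mean_def
      by (subst add.commute) (simp add: binomial_ring power_mult_distrib mult_ac)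
    also have "\<dots> = (\<Sum>j\<le>m. (real (m choose j) * (sin \<theta> * sin \<alpha>) ^ j * (cos \<theta> * cos \<alpha>) ^ (m - j)) * w j)"
      by (subst integral_sum) (auto intro!: integrable_continuous_real continuous_intros
          simp: w_def sum_divide_distrib)
    also have "\<dots> = poly q (cos \<theta>)"
      unfolding q_def poly_sum
    proof (intro sum.cong refl)
      fix j assume "j \<in> {..m}"
      show "real (m choose j) * (sin \<theta> * sin \<alpha>) ^ j * (cos \<theta> * cos \<alpha>) ^ (m - j) * w j =
        poly (smult (real (m choose j) * w j * cos \<alpha> ^ (m - j) * sin \<alpha> ^ j)
          ([:1, 0, -1:] ^ (j div 2) * monom 1 (m - j))) (cos \<theta>)"
      proof (cases "even j")
        case True
        then have "sin \<theta> ^ j = (1 - cos \<theta> * cos \<theta>) ^ (j div 2)"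
          by (metis dvd_mult_div_cancel power_mult sin_squared_eq power2_eq_square)
        then show ?thesis by (simp add: poly_monom power_mult_distrib mult_ac)
      next
        case False
        then show ?thesis by (simp add: w_def integral_cos_power_odd)
      qed
    qed
    finally show ?thesis by simp
  qed
  ultimately show ?thesis by blast
qed

lemma azimuthal_mean_poly:
  "\<exists>q. degree q \<le> degree p \<and> (\<forall>\<theta>. poly q (cos \<theta>) = azimuthal_mean (poly p) \<alpha> \<theta>)"
proof -
  obtain q where q: "\<And>m. degree (q m) \<le> m"
    "\<And>m \<theta>. poly (q m) (cos \<theta>) = azimuthal_mean (\<lambda>s. s ^ m) \<alpha> \<theta>"
    using azimuthal_mean_power[of _ \<alpha>] by metis
  define r where "r = (\<Sum>m\<le>degree p. smult (coeff p m) (q m))"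
  have "degree r \<le> degree p"
    unfolding r_def
    by (intro degree_sum_le) (auto intro!: order.trans[OF degree_smult_le] order.trans[OF q(1)])
  moreover have "poly r (cos \<theta>) = azimuthal_mean (poly p) \<alpha> \<theta>" for \<theta>
  proof -
    have "azimuthal_mean (poly p) \<alpha> \<theta> = integral {0..2*pi} (\<lambda>\<phi>. \<Sum>m\<le>degree p.
        coeff p m * (cos \<theta> * cos \<alpha> + sin \<theta> * sin \<alpha> * cos \<phi>) ^ m) / (2 * pi)"
      unfolding azimuthal_mean_def by (simp add: poly_altdef)
    also have "\<dots> = (\<Sum>m\<le>degree p. coeff p m * azimuthal_mean (\<lambda>s. s ^ m) \<alpha> \<theta>)"
      by (subst integral_sum) (auto intro!: integrable_continuous_real continuous_intros
          simp: azimuthal_mean_def sum_divide_distrib)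
    finally show ?thesis by (simp add: r_def poly_sum q(2))
  qed
  ultimately show ?thesis by blast
qed

text \<open>Turning the mean into an operator on polynomials makes \<open>legendre_span\<close> and
  \<open>legendre_ip\<close> applicable. The values at cos theta cover [-1, 1], so the choice is in
  fact unique.\<close>

definition azimuthal_poly :: "real \<Rightarrow> real poly \<Rightarrow> real poly" where
  "azimuthal_poly \<alpha> p =
     (SOME q. degree q \<le> degree p \<and> (\<forall>\<theta>. poly q (cos \<theta>) = azimuthal_mean (poly p) \<alpha> \<theta>))"

lemma azimuthal_poly:
  shows degree_azimuthal_poly_le: "degree (azimuthal_poly \<alpha> p) \<le> degree p"
    and poly_azimuthal_poly: "poly (azimuthal_poly \<alpha> p) (cos \<theta>) = azimuthal_mean (poly p) \<alpha> \<theta>"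
  using someI_ex[OF azimuthal_mean_poly[of p \<alpha>]] unfolding azimuthal_poly_def by blast+

section \<open>Zonal integrals and the Legendre product formula\<close>

definition meridian :: "real \<Rightarrow> real^3" where
  "meridian \<alpha> = vector [sin \<alpha>, 0, cos \<alpha>]"

lemma meridian_nth [simp]: "meridian \<alpha> $ 1 = sin \<alpha>" "meridian \<alpha> $ 2 = 0" "meridian \<alpha> $ 3 = cos \<alpha>"
  by (simp_all add: meridian_def)

text \<open>The substitution s = cos theta. The factor 1/2 makes \<open>legendre_ip\<close> the mean
  over the unit sphere for functions of the third coordinate.\<close>

lemma legendre_ip_eq_integral_cos:
  "legendre_ip f g = integral {0..pi} (\<lambda>\<theta>. poly f (cos \<theta>) * poly g (cos \<theta>) * sin \<theta>) / 2"
proof -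
  \<comment> \<open>Cosine decreases, so the first of the two integrals runs over an empty interval
    and the second enters with a minus sign.\<close>
  have "((\<lambda>\<theta>. (- sin \<theta>) *\<^sub>R (poly f (cos \<theta>) * poly g (cos \<theta>))) has_integral
      (integral {cos 0..cos pi} (\<lambda>s. poly f s * poly g s) - integral {cos pi..cos 0} (\<lambda>s. poly f s * poly g s))) {0..pi}"
    by (rule has_integral_substitution_general[where s = "{}" and c = "-1" and d = 1])
      (auto intro!: continuous_intros derivative_eq_intros
        simp flip: has_real_derivative_iff_has_vector_derivative)
  then have "((\<lambda>\<theta>. - (poly f (cos \<theta>) * poly g (cos \<theta>) * sin \<theta>)) has_integral
      - integral {-1..1} (\<lambda>s. poly f s * poly g s)) {0..pi}"
    by (simp add: mult_ac)
  from has_integral_neg[OF this]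
  have "((\<lambda>\<theta>. poly f (cos \<theta>) * poly g (cos \<theta>) * sin \<theta>) has_integral
      integral {-1..1} (\<lambda>s. poly f s * poly g s)) {0..pi}"
    by simp
  then show ?thesis by (simp add: legendre_ip_def integral_unique)
qed

text \<open>With the first axis at the pole, \<open>f\<close> does not depend on phi, and the inner
  Fubini integral is 2 pi times an azimuthal mean; the other factor 2 comes from
  \<open>legendre_ip\<close>.\<close>

lemma pair_integral_meridian:
  "pair_integral f g (meridian 0) (meridian \<alpha>) = 4 * pi * legendre_ip f (azimuthal_poly \<alpha> g)"
proof -
  let ?F = "\<lambda>\<theta> \<phi>. poly f (lin_sph 0 0 1 \<theta> \<phi>) * poly g (lin_sph (sin \<alpha>) 0 (cos \<alpha>) \<theta> \<phi>) * sin \<theta>"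
  have cont: "continuous_on (cbox (0,0) (pi, 2*pi)) (\<lambda>(\<theta>,\<phi>). ?F \<theta> \<phi>)"
    by (auto simp: case_prod_unfold intro!: continuous_intros)
  have inner: "integral (cbox 0 (2*pi)) (?F \<theta>) =
      2 * pi * (poly f (cos \<theta>) * poly (azimuthal_poly \<alpha> g) (cos \<theta>) * sin \<theta>)" for \<theta>
    by (simp add: poly_azimuthal_poly azimuthal_mean_def lin_sph_def mult_ac add.commute)
  have "pair_integral f g (meridian 0) (meridian \<alpha>) =
      integral (cbox 0 pi) (\<lambda>\<theta>. integral (cbox 0 (2*pi)) (?F \<theta>))"
    using integral_prod_continuous[OF cont] by (simp add: pair_integral_eq del: box_real)
  also have "\<dots> = 4 * pi * legendre_ip f (azimuthal_poly \<alpha> g)"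
    unfolding inner by (simp add: legendre_ip_eq_integral_cos)
  finally show ?thesis .
qed

lemma pair_integral_commute: "pair_integral f g \<eta> \<zeta> = pair_integral g f \<zeta> \<eta>"
  by (simp add: pair_integral_def mult.commute)

text \<open>Turning by -alpha about the y-axis and then by a half-turn about the z-axis interchanges
  the pole and \<open>meridian \<alpha>\<close>. This symmetry is the selfadjointness of the
  azimuthal mean.\<close>

lemma pair_integral_meridian_commute:
  "pair_integral f g (meridian 0) (meridian \<alpha>) = pair_integral g f (meridian 0) (meridian \<alpha>)"
proof -
  have "rot_z pi (rot_y (-\<alpha>) (meridian \<alpha>)) = meridian 0"
    "rot_z pi (rot_y (-\<alpha>) (meridian 0)) = meridian \<alpha>"
    using sin_cos_squared_add3[of \<alpha>] by (simp_all add: vec_eq_iff forall_3 mult.commute add.commute)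
  then show ?thesis
    by (metis pair_integral_commute pair_integral_rot_y pair_integral_rot_z)
qed

lemma azimuthal_poly_selfadjoint:
  "legendre_ip f (azimuthal_poly \<alpha> g) = legendre_ip g (azimuthal_poly \<alpha> f)"
  using pair_integral_meridian_commute[of f g \<alpha>] by (simp add: pair_integral_meridian)

lemma legendre_ip_low_degree:
  assumes "degree p \<le> m" "m < n"
  shows "legendre_ip (legendre n) p = 0"
proof -
  obtain a where a: "p = (\<Sum>j\<le>m. smult (a j) (legendre j))"
    using legendre_span[OF assms(1)] by blast
  show ?thesis
    unfolding a legendre_ip_sum_right legendre_ip_smult_right legendre_orthogonal
    using assms(2) by (intro sum.neutral) auto
qed

text \<open>Averaging over the azimuth is selfadjoint and does not raise the degree, so it is
  diagonal in the Legendre basis; the eigenvalue is read off at the pole.\<close>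

lemma azimuthal_poly_legendre:
  "azimuthal_poly \<alpha> (legendre l) = smult (poly (legendre l) (cos \<alpha>)) (legendre l)"
proof -
  have deg: "degree (azimuthal_poly \<alpha> (legendre m)) \<le> m" for m
    using degree_azimuthal_poly_le degree_legendre_le order.trans by blast
  obtain a where a: "azimuthal_poly \<alpha> (legendre l) = (\<Sum>m\<le>l. smult (a m) (legendre m))"
    using legendre_span[OF deg] by blast
  have "a m = 0" if "m < l" for m
  proof -
    have "legendre_ip (legendre m) (azimuthal_poly \<alpha> (legendre l)) = a m / (2 * real m + 1)"
      unfolding a legendre_ip_sum_right legendre_ip_smult_right legendre_orthogonal
      using that by (simp add: if_distrib sum.delta cong: if_cong)
    \<comment> \<open>Selfadjointness moves the operator onto P_m, where the result has degree at
      most m < l and is orthogonal to P_l.\<close>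
    moreover have "legendre_ip (legendre m) (azimuthal_poly \<alpha> (legendre l)) = 0"
      using azimuthal_poly_selfadjoint legendre_ip_low_degree[OF deg that] by simp
    moreover have "2 * real m + 1 \<noteq> 0" using of_nat_0_le_iff[of m, where 'a = real] by linarith
    ultimately show ?thesis by simp
  qed
  then have eq: "azimuthal_poly \<alpha> (legendre l) = smult (a l) (legendre l)"
    unfolding a by (subst sum.remove[of _ l]) auto
  have "a l = poly (azimuthal_poly \<alpha> (legendre l)) (cos 0)"
    by (simp add: eq legendre_1)
  also have "\<dots> = poly (legendre l) (cos \<alpha>)"
    unfolding poly_azimuthal_poly by (simp add: azimuthal_mean_def)
  finally show ?thesis using eq by simp
qed

text \<open>The classical product formula, which is the eigenvalue equation evaluated at cos
  theta.\<close>

lemma azimuthal_mean_legendre: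
  "azimuthal_mean (poly (legendre l)) \<alpha> \<theta> = poly (legendre l) (cos \<alpha>) * poly (legendre l) (cos \<theta>)"
  using poly_azimuthal_poly[of \<alpha> "legendre l" \<theta>] by (simp add: azimuthal_poly_legendre)

text \<open>Evaluate the product formula at a point where $|P_l|$ is maximal.\<close>

lemma abs_legendre_le_1:
  assumes "\<bar>t\<bar> \<le> 1"
  shows "\<bar>poly (legendre l) t\<bar> \<le> 1"
proof -
  obtain s where s: "s \<in> {-1..1}" "\<And>t. t \<in> {-1..1} \<Longrightarrow> \<bar>poly (legendre l) t\<bar> \<le> \<bar>poly (legendre l) s\<bar>"
    using continuous_attains_sup[of "{-1..1::real}" "\<lambda>t. \<bar>poly (legendre l) t\<bar>"]
    by (force intro!: continuous_intros)
  define M where "M = \<bar>poly (legendre l) s\<bar>"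
  have "M \<ge> 1" using s(2)[of 1] by (simp add: M_def legendre_1)
  define \<theta> where "\<theta> = arccos s"
  define \<alpha> where "\<alpha> = arccos t"
  have cs: "cos \<theta> = s" "cos \<alpha> = t" using s assms by (auto simp: \<theta>_def \<alpha>_def)
  have range: "cos \<theta> * cos \<alpha> + sin \<theta> * sin \<alpha> * cos \<phi> \<in> {-1..1}" for \<phi>
  proof -
    \<comment> \<open>A convex combination of two cosines, hence in [-1, 1].\<close>
    have "cos \<theta> * cos \<alpha> + sin \<theta> * sin \<alpha> * cos \<phi> =
        (1 + cos \<phi>) / 2 * cos (\<theta> - \<alpha>) + (1 - cos \<phi>) / 2 * cos (\<theta> + \<alpha>)"
      by (simp add: cos_diff cos_add field_simps)
    also have "\<bar>\<dots>\<bar> \<le> (1 + cos \<phi>) / 2 * 1 + (1 - cos \<phi>) / 2 * 1"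
    proof -
      have "0 \<le> (1 + cos \<phi>) / 2" using add_left_mono[OF cos_ge_minus_one, of 1 \<phi>] by simp
      moreover have "0 \<le> (1 - cos \<phi>) / 2" by simp
      ultimately show ?thesis
        by (intro order.trans[OF abs_triangle_ineq] add_mono)
          (simp_all only: abs_mult abs_of_nonneg mult_left_mono abs_cos_le_one)
    qed
    finally show ?thesis by (auto simp: field_simps abs_le_iff)
  qed
  have "norm (integral {0..2*pi} (\<lambda>\<phi>. poly (legendre l) (cos \<theta> * cos \<alpha> + sin \<theta> * sin \<alpha> * cos \<phi>)))
      \<le> M * (2 * pi - 0)"
    by (rule integral_bound) (auto intro!: continuous_intros s(2)[OF range] simp: M_def)
  then have "\<bar>azimuthal_mean (poly (legendre l)) \<alpha> \<theta>\<bar> \<le> M"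
    by (simp add: azimuthal_mean_def field_simps)
  \<comment> \<open>The maximum \<open>M\<close> is at least P_l(1) = 1, so it can be cancelled
    afterwards.\<close>
  then have "\<bar>poly (legendre l) t\<bar> * M \<le> 1 * M"
    unfolding azimuthal_mean_legendre cs by (simp add: abs_mult M_def)
  then show ?thesis using \<open>M \<ge> 1\<close> by simp
qed

text \<open>Spherical coordinates: undoing the longitude by a rotation about the z-axis leaves a
  point of the meridian phi = 0.\<close>

lemma unit_vector_polar:
  fixes \<eta> :: "real^3"
  assumes "norm \<eta> = 1"
  obtains \<alpha> \<gamma> where "rot_z \<gamma> \<eta> = meridian \<alpha>"
proof -
  have n: "(\<eta>$1)\<^sup>2 + (\<eta>$2)\<^sup>2 + (\<eta>$3)\<^sup>2 = 1"
    using assms by (simp add: norm_eq_1 inner_vec_def sum_3 power2_eq_square)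
  define \<rho> where "\<rho> = sqrt ((\<eta>$1)\<^sup>2 + (\<eta>$2)\<^sup>2)"
  have \<rho>: "\<rho>\<^sup>2 = (\<eta>$1)\<^sup>2 + (\<eta>$2)\<^sup>2" by (simp add: \<rho>_def)
  have "\<exists>\<gamma>. \<eta>$1 = \<rho> * cos \<gamma> \<and> \<eta>$2 = \<rho> * sin \<gamma>"
  proof (cases "\<rho> = 0")
    case True
    then show ?thesis using \<rho> by (simp add: sum_power2_eq_zero_iff)
  next
    case False
    then have "(\<eta>$1 / \<rho>)\<^sup>2 + (\<eta>$2 / \<rho>)\<^sup>2 = 1" by (simp add: power_divide \<rho>[symmetric] flip: add_divide_distrib)
    then obtain \<gamma> where "\<eta>$1 / \<rho> = cos \<gamma>" "\<eta>$2 / \<rho> = sin \<gamma>"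
      using sincos_total_2pi by metis
    then show ?thesis using False by (auto simp: field_simps)
  qed
  then obtain \<gamma> where \<gamma>: "\<eta>$1 = \<rho> * cos \<gamma>" "\<eta>$2 = \<rho> * sin \<gamma>" by blast
  have "(\<eta>$3)\<^sup>2 + \<rho>\<^sup>2 = 1" using n \<rho> by simp
  then obtain \<alpha> where \<alpha>: "\<eta>$3 = cos \<alpha>" "\<rho> = sin \<alpha>" using sincos_total_2pi by metis
  have "\<rho> * cos \<gamma> * cos \<gamma> + \<rho> * sin \<gamma> * sin \<gamma> = \<rho>"
    using sin_cos_squared_add[of \<gamma>] by algebra
  then have "rot_z (-\<gamma>) \<eta> = meridian \<alpha>"
    using \<gamma> \<alpha> by (simp add: vec_eq_iff forall_3)
  then show thesis by (rule that)
qed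

lemma inner_rot [simp]: "rot_y \<beta> v \<bullet> rot_y \<beta> w = v \<bullet> w" "rot_z \<beta> v \<bullet> rot_z \<beta> w = v \<bullet> w"
proof -
  have "sin \<beta> * sin \<beta> = 1 - cos \<beta> * cos \<beta>"
    using sin_squared_eq[of \<beta>] by (simp add: power2_eq_square)
  then show "rot_y \<beta> v \<bullet> rot_y \<beta> w = v \<bullet> w" "rot_z \<beta> v \<bullet> rot_z \<beta> w = v \<bullet> w"
    unfolding inner_vec_def by (simp_all add: sum_3) algebra+
qed

text \<open>A z-rotation and a y-rotation carry eta to the pole; a further z-rotation fixes the pole
  and brings the image of zeta to the meridian phi = 0. Inner products are preserved, which
  identifies cos alpha.\<close>

lemma pair_integral_eq_meridian:
  fixes \<eta> \<zeta> :: "real^3"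
  assumes "norm \<eta> = 1" "norm \<zeta> = 1"
  obtains \<alpha> where "cos \<alpha> = \<eta> \<bullet> \<zeta>"
    "\<And>f g. pair_integral f g \<eta> \<zeta> = pair_integral f g (meridian 0) (meridian \<alpha>)"
proof -
  obtain a c where ac: "rot_z c \<eta> = meridian a" using unit_vector_polar[OF assms(1)] .
  define \<zeta>' where "\<zeta>' = rot_y (-a) (rot_z c \<zeta>)"
  have \<eta>': "rot_y (-a) (rot_z c \<eta>) = meridian 0"
    unfolding ac by (simp add: vec_eq_iff forall_3 mult.commute flip: power2_eq_square)
  have "norm \<zeta>' = 1" using assms by (simp add: norm_eq_1 \<zeta>'_def)
  then obtain \<alpha> d where d: "rot_z d \<zeta>' = meridian \<alpha>" using unit_vector_polar by blast
  have m0: "rot_z d (meridian 0) = meridian 0" by (simp add: vec_eq_iff forall_3)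
  have "pair_integral f g \<eta> \<zeta> = pair_integral f g (meridian 0) (meridian \<alpha>)" for f g
    by (metis \<zeta>'_def \<eta>' d m0 pair_integral_rot_y pair_integral_rot_z)
  moreover have "\<eta> \<bullet> \<zeta> = meridian 0 \<bullet> meridian \<alpha>"
    by (metis \<zeta>'_def \<eta>' d m0 inner_rot)
  then have "cos \<alpha> = \<eta> \<bullet> \<zeta>" by (simp add: inner_vec_def sum_3)
  ultimately show thesis using that by blast
qed

text \<open>In standard position the second polynomial is replaced by its eigenvalue times itself,
  and orthogonality on [-1, 1] finishes the computation.\<close>

lemma pair_integral_legendre:
  assumes "norm \<eta> = 1" "norm \<zeta> = 1"
  shows "pair_integral (legendre l) (legendre m) \<eta> \<zeta> =
    (if l = m then 4 * pi / (2 * real l + 1) * poly (legendre l) (\<eta> \<bullet> \<zeta>) else 0)"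
proof -
  obtain \<alpha> where "cos \<alpha> = \<eta> \<bullet> \<zeta>"
    "\<And>f g. pair_integral f g \<eta> \<zeta> = pair_integral f g (meridian 0) (meridian \<alpha>)"
    using pair_integral_eq_meridian[OF assms] by metis
  then show ?thesis
    by (simp add: pair_integral_meridian azimuthal_poly_legendre legendre_ip_smult_right legendre_orthogonal)
qed

section \<open>Expansion of the kernel\<close>

lemma legendre_summable:
  assumes "\<bar>u\<bar> \<le> 1" "\<bar>z\<bar> < (1::real)"
  shows "summable (\<lambda>n. poly (legendre n) u * z ^ n)"
proof (rule summable_comparison_test)
  show "summable (\<lambda>n. \<bar>z\<bar> ^ n)" using assms by (intro summable_geometric) auto
  show "\<exists>N. \<forall>n\<ge>N. norm (poly (legendre n) u * z ^ n) \<le> \<bar>z\<bar> ^ n"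
    using abs_legendre_le_1[OF assms(1)]
    by (auto simp: abs_mult power_abs intro!: mult_left_le_one_le)
qed

text \<open>Comparing coefficients of z^(n+1) on both sides gives exactly the three-term
  recurrence.\<close>

lemma legendre_generating_ode:
  fixes u z :: real
  defines "c \<equiv> \<lambda>n. poly (legendre n) u"
  assumes u: "\<bar>u\<bar> \<le> 1" and z: "\<bar>z\<bar> < 1"
  shows "(1 - 2 * u * z + z\<^sup>2) * (\<Sum>n. diffs c n * z ^ n) = (u - z) * (\<Sum>n. c n * z ^ n)"
proof -
  define F where "F = (\<Sum>n. c n * z ^ n)"
  define F' where "F' = (\<Sum>n. diffs c n * z ^ n)"
  have S0: "(\<lambda>n. c n * z ^ n) sums F"
    using legendre_summable[OF u z] by (simp add: F_def c_def summable_sums)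
  have S1: "(\<lambda>n. diffs c n * z ^ n) sums F'"
    unfolding F'_def
    by (rule summable_sums, rule termdiff_converges[where K = 1])
      (use z legendre_summable[OF u] in \<open>auto simp: c_def\<close>)
  have c01: "c 0 = 1" "c (Suc 0) = u" by (simp_all add: c_def)
  \<comment> \<open>The constant terms 1 and u are split off so that every series below runs over
    the powers z^(n+1).\<close>
  have S0s: "(\<lambda>n. c (Suc n) * z ^ Suc n) sums (F - 1)"
    using S0 by (subst sums_Suc_iff) (simp add: c01)
  have S1s: "(\<lambda>n. diffs c (Suc n) * z ^ Suc n) sums (F' - u)"
    using S1 by (subst sums_Suc_iff) (simp add: c01 diffs_def)
  have zS1: "(\<lambda>n. z * (diffs c n * z ^ n)) sums (z * F')" by (intro sums_mult S1)
  have nS: "(\<lambda>n. real n * c n * z ^ n) sums (z * F')"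
    using zS1 sums_Suc_iff[of "\<lambda>n. real n * c n * z ^ n" "z * F'"] by (simp add: diffs_def mult_ac)
  have "(\<lambda>n. diffs c (Suc n) * z ^ Suc n - 2 * u * (z * (diffs c n * z ^ n))
      - u * (c (Suc n) * z ^ Suc n) + z * (real n * c n * z ^ n) + z * (c n * z ^ n)) sums
      ((F' - u) - 2 * u * (z * F') - u * (F - 1) + z * (z * F') + z * F)"
    by (intro sums_add sums_diff sums_mult S0 S0s S1s zS1 nS)
  moreover have "diffs c (Suc n) * z ^ Suc n - 2 * u * (z * (diffs c n * z ^ n))
      - u * (c (Suc n) * z ^ Suc n) + z * (real n * c n * z ^ n) + z * (c n * z ^ n) = 0" for n
  proof -
    have "(real n + 2) * c (Suc (Suc n)) = (2 * real n + 3) * u * c (Suc n) - (real n + 1) * c n"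
      unfolding c_def by (rule poly_legendre_rec)
    moreover have "diffs c (Suc n) * z ^ Suc n - 2 * u * (z * (diffs c n * z ^ n))
      - u * (c (Suc n) * z ^ Suc n) + z * (real n * c n * z ^ n) + z * (c n * z ^ n) =
      z ^ Suc n * ((real n + 2) * c (Suc (Suc n)) - ((2 * real n + 3) * u * c (Suc n) - (real n + 1) * c n))"
      by (simp add: diffs_def algebra_simps)
    ultimately show ?thesis by simp
  qed
  ultimately have "(\<lambda>n. 0) sums ((F' - u) - 2 * u * (z * F') - u * (F - 1) + z * (z * F') + z * F)"
    by simp
  then have "(F' - u) - 2 * u * (z * F') - u * (F - 1) + z * (z * F') + z * F = 0"
    using sums_unique2[OF sums_zero] by metis
  then show ?thesis unfolding F_def[symmetric] F'_def[symmetric] by algebra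
qed

text \<open>By the differential equation the series times the square root has derivative 0 on [0,
  1), and its value at 0 is 1.\<close>

lemma legendre_generating_function:
  fixes u \<rho> :: real
  assumes u: "\<bar>u\<bar> \<le> 1" and \<rho>: "0 \<le> \<rho>" "\<rho> < 1"
  shows "(\<lambda>l. poly (legendre l) u * \<rho> ^ l) sums (1 / sqrt (1 - 2 * u * \<rho> + \<rho>\<^sup>2))"
proof -
  define c where "c = (\<lambda>n. poly (legendre n) u)"
  define F where "F = (\<lambda>z. \<Sum>n. c n * z ^ n)"
  define Q where "Q = (\<lambda>z. 1 - 2 * u * z + z\<^sup>2)"
  have Qpos: "Q z > 0" if "0 \<le> z" "z < 1" for z
  proof -
    have "0 < (1 - z)\<^sup>2" "0 \<le> 2 * z * (1 - u)" using that u by auto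
    then have "0 < (1 - z)\<^sup>2 + 2 * z * (1 - u)" by linarith
    then show ?thesis by (simp add: Q_def algebra_simps power2_eq_square)
  qed
  have der: "((\<lambda>z. F z * sqrt (Q z)) has_real_derivative 0) (at z)" if z: "0 \<le> z" "z < 1" for z
  proof -
    have z': "\<bar>z\<bar> < 1" using z by simp
    \<comment> \<open>The midpoint of z and 1 lies inside the disc of convergence, as termwise
      differentiation at z requires.\<close>
    define K where "K = (z + 1) / 2"
    have K: "norm z < norm K" "\<bar>K\<bar> < 1" using z by (auto simp: K_def)
    have F': "(F has_real_derivative (\<Sum>n. diffs c n * z ^ n)) (at z)"
      unfolding F_def by (rule termdiffs_strong[OF _ K(1)]) (simp add: c_def legendre_summable u K)
    have Q': "((\<lambda>z. sqrt (Q z)) has_real_derivative (z - u) / sqrt (Q z)) (at z)"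
      using Qpos[OF z] unfolding Q_def
      by (auto intro!: derivative_eq_intros simp: field_simps)
    have "Q z * (\<Sum>n. diffs c n * z ^ n) = (u - z) * F z"
      using legendre_generating_ode[OF u z'] by (simp add: Q_def F_def c_def)
    moreover have "sqrt (Q z) * sqrt (Q z) = Q z" "sqrt (Q z) \<noteq> 0" using Qpos[OF z] by auto
    moreover have "D * S + (z - u) / S * w = (S * S * D - (u - z) * w) / S" if "S \<noteq> 0" for D S w :: real
      using that by (simp add: field_simps)
    ultimately have "(\<Sum>n. diffs c n * z ^ n) * sqrt (Q z) + (z - u) / sqrt (Q z) * F z = 0"
      by (metis cancel_comm_monoid_add_class.diff_cancel div_0)
    then show ?thesis using DERIV_mult[OF F' Q'] by simp
  qed
  have "F \<rho> * sqrt (Q \<rho>) = F 0 * sqrt (Q 0)"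
  proof (cases "\<rho> = 0")
    case False
    then show ?thesis
      by (intro DERIV_isconst2[of 0 \<rho> "\<lambda>z. F z * sqrt (Q z)"])
        (use \<rho> der in \<open>auto intro!: continuous_at_imp_continuous_on DERIV_isCont[OF der]\<close>)
  qed simp
  also have "\<dots> = 1"
    using powser_zero[of c] by (simp add: F_def Q_def c_def)
  finally have "F \<rho> = 1 / sqrt (Q \<rho>)" using Qpos[OF \<rho>] by (simp add: field_simps)
  then show ?thesis
    using summable_sums[OF legendre_summable[OF u, of \<rho>]] \<rho> by (simp add: F_def c_def Q_def)
qed

lemma inner_unit_le_1:
  assumes "norm \<eta> = 1" "norm \<zeta> = 1"
  shows "\<bar>\<eta> \<bullet> \<zeta>\<bar> \<le> 1"
  using Cauchy_Schwarz_ineq2[of \<eta> \<zeta>] assms by simp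

text \<open>The law of cosines turns the distance into R times the square root in the generating
  function at a/R.\<close>

lemma kernel_expansion:
  fixes \<eta> \<zeta> :: "real^3"
  assumes "norm \<eta> = 1" "norm \<zeta> = 1" "0 \<le> a" "a < R"
  shows "(\<lambda>l. a ^ l / R ^ (l + 1) * poly (legendre l) (\<eta> \<bullet> \<zeta>)) sums kernel (a *\<^sub>R \<eta>) (R *\<^sub>R \<zeta>)"
proof -
  define u where "u = \<eta> \<bullet> \<zeta>"
  have R: "R > 0" using assms by simp
  have eq1: "\<eta> \<bullet> \<eta> = 1" "\<zeta> \<bullet> \<zeta> = 1" using assms by (simp_all add: norm_eq_1)
  have "(norm (a *\<^sub>R \<eta> - R *\<^sub>R \<zeta>))\<^sup>2 = a\<^sup>2 - 2 * a * R * u + R\<^sup>2"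
    unfolding power2_norm_eq_inner
    by (simp add: algebra_simps eq1 u_def inner_commute power2_eq_square)
  also have "\<dots> = R\<^sup>2 * (1 - 2 * u * (a / R) + (a / R)\<^sup>2)"
    using R by (simp add: field_simps power2_eq_square)
  finally have "norm (a *\<^sub>R \<eta> - R *\<^sub>R \<zeta>) = R * sqrt (1 - 2 * u * (a / R) + (a / R)\<^sup>2)"
    using R by (metis abs_of_pos norm_ge_zero real_sqrt_abs real_sqrt_mult real_sqrt_pow2_iff abs_norm_cancel)
  then have k: "kernel (a *\<^sub>R \<eta>) (R *\<^sub>R \<zeta>) = 1 / R * (1 / sqrt (1 - 2 * u * (a / R) + (a / R)\<^sup>2))"
    by (simp add: kernel_def)
  have "(\<lambda>l. 1 / R * (poly (legendre l) u * (a / R) ^ l)) sums kernel (a *\<^sub>R \<eta>) (R *\<^sub>R \<zeta>)"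
    unfolding k
    by (intro sums_mult legendre_generating_function) (use assms R inner_unit_le_1 in \<open>auto simp: u_def\<close>)
  then show ?thesis by (simp add: u_def power_divide mult_ac)
qed

text \<open>Since |P_l| <= 1 the tail is dominated by a geometric series with sum (a/R)^(c+1)/(R -
  a), which is largest at a = r1 and R = r2.\<close>

lemma kernel_tail_bound:
  fixes \<eta> \<zeta> :: "real^3"
  assumes "norm \<eta> = 1" "norm \<zeta> = 1" "0 \<le> a" "a \<le> r1" "r1 < r2" "r2 \<le> R"
  shows "\<bar>kernel (a *\<^sub>R \<eta>) (R *\<^sub>R \<zeta>) - (\<Sum>l\<le>c. a ^ l / R ^ (l + 1) * poly (legendre l) (\<eta> \<bullet> \<zeta>))\<bar>
    \<le> (r1 / r2) ^ (c + 1) / (r2 - r1)"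
proof -
  define f where "f l = a ^ l / R ^ (l + 1) * poly (legendre l) (\<eta> \<bullet> \<zeta>)" for l
  define \<rho> where "\<rho> = a / R"
  have pos: "0 < r2" "0 < R" "a < R" using assms by auto
  have \<rho>: "0 \<le> \<rho>" "\<rho> < 1" "\<rho> \<le> r1 / r2" using assms pos by (auto simp: \<rho>_def intro!: frac_le)
  have "f sums kernel (a *\<^sub>R \<eta>) (R *\<^sub>R \<zeta>)"
    unfolding f_def by (rule kernel_expansion) (use assms pos in auto)
  from sums_split_initial_segment[OF this, of "c + 1"]
  have tail: "(\<lambda>l. f (l + (c + 1))) sums (kernel (a *\<^sub>R \<eta>) (R *\<^sub>R \<zeta>) - (\<Sum>l\<le>c. f l))"
    by (simp add: lessThan_Suc_atMost)
  have geo: "(\<lambda>l. \<rho> ^ (c + 1) / R * \<rho> ^ l) sums (\<rho> ^ (c + 1) / R * (1 / (1 - \<rho>)))"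
    by (intro sums_mult geometric_sums) (use \<rho> in auto)
  have le: "norm (f (l + (c + 1))) \<le> \<rho> ^ (c + 1) / R * \<rho> ^ l" for l
  proof -
    have "norm (f (l + (c + 1))) = \<rho> ^ (l + (c + 1)) / R * \<bar>poly (legendre (l + (c + 1))) (\<eta> \<bullet> \<zeta>)\<bar>"
      using pos assms by (simp add: f_def \<rho>_def abs_mult power_divide)
    also have "\<dots> \<le> \<rho> ^ (l + (c + 1)) / R * 1"
      using abs_legendre_le_1[OF inner_unit_le_1[OF assms(1,2)]] pos \<rho> by (intro mult_left_mono) auto
    finally show ?thesis by (simp add: power_add mult_ac)
  qed
  have "\<bar>kernel (a *\<^sub>R \<eta>) (R *\<^sub>R \<zeta>) - (\<Sum>l\<le>c. f l)\<bar> \<le> \<rho> ^ (c + 1) / R * (1 / (1 - \<rho>))"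
    using norm_suminf_le[OF le sums_summable[OF geo]]
    by (simp only: sums_unique[OF tail, symmetric] sums_unique[OF geo, symmetric] real_norm_def)
  also have "\<dots> = \<rho> ^ (c + 1) / (R - a)"
    using pos by (simp add: \<rho>_def field_simps)
  also have "\<dots> \<le> (r1 / r2) ^ (c + 1) / (r2 - r1)"
    using \<rho> assms pos by (intro frac_le power_mono) auto
  finally show ?thesis by (simp add: f_def)
qed

text \<open>The sum over $j, l$ on the left is the mean over $Y$ of the function in the norm on the right times
  $G = \sum_m (2m+1) t^{m+1} P_m(\zeta \cdot v)$, and the mean of $G^2$ is at most
  $\sum_{m \le c} (2m+1) = (c+1)^2$; this is where the factor $c + 1$ comes from.\<close>

lemma reproducing_bound:
  fixes v :: "'b \<Rightarrow> real^3" and \<eta> :: "'i \<Rightarrow> real^3" and b :: "'i \<Rightarrow> nat \<Rightarrow> real"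
  assumes Y: "finite Y" "Y \<noteq> {}"
    and D: "\<And>l m \<eta> \<zeta>. l \<le> c \<Longrightarrow> m \<le> c \<Longrightarrow> norm \<eta> = 1 \<Longrightarrow> norm \<zeta> = 1 \<Longrightarrow>
      (\<Sum>y\<in>Y. poly (legendre l) (\<eta> \<bullet> v y) * poly (legendre m) (\<zeta> \<bullet> v y)) =
      real (card Y) * (if l = m then poly (legendre l) (\<eta> \<bullet> \<zeta>) / (2 * real l + 1) else 0)"
    and t: "0 \<le> t" "t \<le> 1" and \<zeta>: "norm \<zeta> = 1" and \<eta>: "\<And>j. j \<in> I \<Longrightarrow> norm (\<eta> j) = 1"
  shows "\<bar>\<Sum>j\<in>I. \<Sum>l\<le>c. b j l * t ^ (l + 1) * poly (legendre l) (\<eta> j \<bullet> \<zeta>)\<bar> \<le>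
    (real c + 1) * (L2_set (\<lambda>y. \<Sum>j\<in>I. \<Sum>l\<le>c. b j l * poly (legendre l) (\<eta> j \<bullet> v y)) Y / sqrt (card Y))"
proof -
  define N where "N = real (card Y)"
  have N: "N > 0" using Y by (simp add: N_def card_gt_0_iff)
  define f where "f y = (\<Sum>j\<in>I. \<Sum>l\<le>c. b j l * poly (legendre l) (\<eta> j \<bullet> v y))" for y
  define G where "G y = (\<Sum>m\<le>c. (2 * real m + 1) * t ^ (m + 1) * poly (legendre m) (\<zeta> \<bullet> v y))" for y
  have odd_ne: "2 * real l + 1 \<noteq> 0" for l using of_nat_0_le_iff[of l, where 'a = real] by linarith
  \<comment> \<open>Summation against \<open>G\<close> keeps only degree l; its weight 2l+1 cancels
    the squared norm and t^(l+1) remains.\<close>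
  have inner: "(\<Sum>y\<in>Y. poly (legendre l) (\<xi> \<bullet> v y) * G y) = N * (t ^ (l + 1) * poly (legendre l) (\<xi> \<bullet> \<zeta>))"
    if "l \<le> c" "norm \<xi> = 1" for l \<xi>
  proof -
    have "(\<Sum>y\<in>Y. poly (legendre l) (\<xi> \<bullet> v y) * G y) =
        (\<Sum>m\<le>c. (2 * real m + 1) * t ^ (m + 1) *
          (\<Sum>y\<in>Y. poly (legendre l) (\<xi> \<bullet> v y) * poly (legendre m) (\<zeta> \<bullet> v y)))"
      unfolding G_def sum_distrib_left by (subst sum.swap) (simp add: mult_ac)
    also have "\<dots> = (\<Sum>m\<le>c. if l = m then N * (t ^ (l + 1) * poly (legendre l) (\<xi> \<bullet> \<zeta>)) else 0)"
      by (intro sum.cong refl) (use that \<zeta> odd_ne in \<open>auto simp: D N_def\<close>)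
    finally show ?thesis using that by simp
  qed
  have fG: "(\<Sum>y\<in>Y. f y * G y) = N * (\<Sum>j\<in>I. \<Sum>l\<le>c. b j l * t ^ (l + 1) * poly (legendre l) (\<eta> j \<bullet> \<zeta>))"
  proof -
    have "(\<Sum>y\<in>Y. f y * G y) = (\<Sum>j\<in>I. \<Sum>l\<le>c. b j l * (\<Sum>y\<in>Y. poly (legendre l) (\<eta> j \<bullet> v y) * G y))"
      unfolding f_def sum_distrib_left sum_distrib_right
      by (subst sum.swap, rule sum.cong[OF refl], subst sum.swap) (simp add: mult_ac)
    also have "\<dots> = (\<Sum>j\<in>I. \<Sum>l\<le>c. b j l * (N * (t ^ (l + 1) * poly (legendre l) (\<eta> j \<bullet> \<zeta>))))"
      by (intro sum.cong refl) (use \<eta> in \<open>simp add: inner\<close>)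
    finally show ?thesis by (simp add: sum_distrib_left mult_ac)
  qed
  \<comment> \<open>One factor \<open>G\<close> is expanded and \<open>inner\<close> is applied with
    both axes equal to zeta, where P_m takes the value P_m(1) = 1.\<close>
  have "(\<Sum>y\<in>Y. (G y)\<^sup>2) = (\<Sum>m\<le>c. (2 * real m + 1) * t ^ (m + 1) * (\<Sum>y\<in>Y. poly (legendre m) (\<zeta> \<bullet> v y) * G y))"
    unfolding power2_eq_square
    by (subst (1) G_def) (simp add: sum_distrib_left sum_distrib_right mult_ac sum.swap[of _ Y])
  also have "\<dots> = (\<Sum>m\<le>c. N * ((2 * real m + 1) * (t ^ (m + 1))\<^sup>2))"
  proof (intro sum.cong refl)
    fix m assume "m \<in> {..c}"
    then show "(2 * real m + 1) * t ^ (m + 1) * (\<Sum>y\<in>Y. poly (legendre m) (\<zeta> \<bullet> v y) * G y) =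
        N * ((2 * real m + 1) * (t ^ (m + 1))\<^sup>2)"
      using \<zeta> norm_eq_1[of \<zeta>] by (simp add: inner legendre_1 power2_eq_square)
  qed
  also have "\<dots> \<le> (\<Sum>m\<le>c. N * ((2 * real m + 1) * 1))"
    using N by (intro sum_mono mult_left_mono power_le_one zero_le_power t) auto
  also have "\<dots> = N * (\<Sum>m\<le>c. 2 * real m + 1)" by (simp add: sum_distrib_left)
  also have "(\<Sum>m\<le>c. 2 * real m + 1) = (real c + 1)\<^sup>2"
    by (induction c) (simp_all add: power2_eq_square algebra_simps)
  finally have "L2_set G Y \<le> sqrt (N * (real c + 1)\<^sup>2)"
    unfolding L2_set_def by (rule real_sqrt_le_mono)
  then have G: "L2_set G Y \<le> sqrt N * (real c + 1)" by (simp add: real_sqrt_mult)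
  have "N * \<bar>\<Sum>j\<in>I. \<Sum>l\<le>c. b j l * t ^ (l + 1) * poly (legendre l) (\<eta> j \<bullet> \<zeta>)\<bar> = \<bar>\<Sum>y\<in>Y. f y * G y\<bar>"
    using N by (simp add: fG abs_mult)
  also have "\<dots> \<le> (\<Sum>y\<in>Y. \<bar>f y\<bar> * \<bar>G y\<bar>)" by (rule order.trans[OF sum_abs]) (simp add: abs_mult)
  also have "\<dots> \<le> L2_set f Y * L2_set G Y" by (rule L2_set_mult_ineq)
  also have "\<dots> \<le> L2_set f Y * (sqrt N * (real c + 1))" using G by (rule mult_left_mono) simp
  finally have "N * \<bar>\<Sum>j\<in>I. \<Sum>l\<le>c. b j l * t ^ (l + 1) * poly (legendre l) (\<eta> j \<bullet> \<zeta>)\<bar>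
      \<le> sqrt N * (L2_set f Y * (real c + 1))" by (simp add: mult_ac)
  then have "sqrt N * (sqrt N * \<bar>\<Sum>j\<in>I. \<Sum>l\<le>c. b j l * t ^ (l + 1) * poly (legendre l) (\<eta> j \<bullet> \<zeta>)\<bar>)
      \<le> sqrt N * (L2_set f Y * (real c + 1))" using N by (simp flip: mult.assoc)
  then have "sqrt N * \<bar>\<Sum>j\<in>I. \<Sum>l\<le>c. b j l * t ^ (l + 1) * poly (legendre l) (\<eta> j \<bullet> \<zeta>)\<bar>
      \<le> L2_set f Y * (real c + 1)" using N by simp
  then show ?thesis
    using N unfolding f_def N_def[symmetric] by (simp add: field_simps)
qed

section \<open>Quadrature and the error bound\<close>

lemma finite_exponents: "finite {(i, j, l). i + j + l \<le> (d::nat)}"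
  by (rule finite_subset[of _ "{..d} \<times> {..d} \<times> {..d}"]) auto

lemma poly3_zero: "poly3_deg_le d (\<lambda>x. 0)"
  unfolding poly3_deg_le_def by (rule exI[of _ "\<lambda>_ _ _. 0"]) (auto intro!: sum.neutral[symmetric])

lemma poly3_add:
  assumes "poly3_deg_le d p" "poly3_deg_le d q"
  shows "poly3_deg_le d (\<lambda>x. p x + q x)"
proof -
  obtain a b where "\<And>x. p x = (\<Sum>(i,j,l) \<in> {(i,j,l). i + j + l \<le> d}. a i j l * (x$1)^i * (x$2)^j * (x$3)^l)"
    "\<And>x. q x = (\<Sum>(i,j,l) \<in> {(i,j,l). i + j + l \<le> d}. b i j l * (x$1)^i * (x$2)^j * (x$3)^l)"
    using assms unfolding poly3_deg_le_def by blast
  then show ?thesis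
    unfolding poly3_deg_le_def
    by (intro exI[of _ "\<lambda>i j l. a i j l + b i j l"])
      (auto simp: case_prod_unfold algebra_simps simp flip: sum.distrib)
qed

lemma poly3_sum:
  assumes "\<And>s. s \<in> A \<Longrightarrow> poly3_deg_le d (p s)"
  shows "poly3_deg_le d (\<lambda>x. \<Sum>s\<in>A. p s x)"
  using assms
proof (induction A rule: infinite_finite_induct)
  case (insert s A)
  then show ?case by (simp add: poly3_add)
qed (simp_all add: poly3_zero)

lemma poly3_monomial:
  assumes "i + j + l \<le> d"
  shows "poly3_deg_le d (\<lambda>x. a * (x$1)^i * (x$2)^j * (x$3)^l)"
proof -
  have "a * (x$1)^i * (x$2)^j * (x$3)^l = (\<Sum>(i',j',l') \<in> {(i,j,l). i + j + l \<le> d}.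
      (if (i',j',l') = (i,j,l) then a else 0) * (x$1)^i' * (x$2)^j' * (x$3)^l')" for x :: "real^3"
  proof -
    have "(\<Sum>(i',j',l') \<in> {(i,j,l). i + j + l \<le> d}.
        (if (i',j',l') = (i,j,l) then a else 0) * (x$1)^i' * (x$2)^j' * (x$3)^l') =
      (\<Sum>m \<in> {(i,j,l). i + j + l \<le> d}. if m = (i,j,l) then a * (x$1)^i * (x$2)^j * (x$3)^l else 0)"
      by (intro sum.cong refl) (simp add: case_prod_unfold prod_eq_iff)
    then show ?thesis using assms by (simp add: finite_exponents)
  qed
  then show ?thesis
    unfolding poly3_deg_le_def
    by (intro exI[of _ "\<lambda>i' j' l'. if (i',j',l') = (i,j,l) then a else 0"]) blast
qed

lemma poly3_mult:
  assumes "poly3_deg_le d p" "poly3_deg_le e q"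
  shows "poly3_deg_le (d + e) (\<lambda>x. p x * q x)"
proof -
  obtain a b where p: "\<And>x. p x = (\<Sum>(i,j,l) \<in> {(i,j,l). i + j + l \<le> d}. a i j l * (x$1)^i * (x$2)^j * (x$3)^l)"
    and q: "\<And>x. q x = (\<Sum>(i,j,l) \<in> {(i,j,l). i + j + l \<le> e}. b i j l * (x$1)^i * (x$2)^j * (x$3)^l)"
    using assms unfolding poly3_deg_le_def by blast
  have mono: "poly3_deg_le (d + e) (\<lambda>x. (case m of (i,j,l) \<Rightarrow> a i j l * (x$1)^i * (x$2)^j * (x$3)^l) *
      (case m' of (i,j,l) \<Rightarrow> b i j l * (x$1)^i * (x$2)^j * (x$3)^l))"
    if "m \<in> {(i,j,l). i + j + l \<le> d}" "m' \<in> {(i,j,l). i + j + l \<le> e}" for m m'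
  proof -
    obtain i j l i' j' l' where m: "m = (i,j,l)" "m' = (i',j',l')" by (metis prod_cases3)
    have "poly3_deg_le (d + e) (\<lambda>x. (a i j l * b i' j' l') * (x$1)^(i+i') * (x$2)^(j+j') * (x$3)^(l+l'))"
      using that by (intro poly3_monomial) (auto simp: m)
    then show ?thesis by (simp add: m power_add mult_ac)
  qed
  show ?thesis
    unfolding p q sum_product by (intro poly3_sum mono)
qed

lemma poly3_inner: "poly3_deg_le 1 (\<lambda>x. x \<bullet> \<eta>)"
proof -
  have "poly3_deg_le 1 (\<lambda>x. \<eta>$1 * (x$1)^1 * (x$2)^0 * (x$3)^0 +
      (\<eta>$2 * (x$1)^0 * (x$2)^1 * (x$3)^0 + \<eta>$3 * (x$1)^0 * (x$2)^0 * (x$3)^1))"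
    by (intro poly3_add poly3_monomial) auto
  then show ?thesis by (simp add: inner_vec_def sum_3 mult_ac add_ac)
qed

lemma poly3_power_inner: "poly3_deg_le n (\<lambda>x. (x \<bullet> \<eta>) ^ n)"
proof (induction n)
  case 0
  then show ?case using poly3_monomial[of 0 0 0 0 1] by simp
next
  case (Suc n)
  then show ?case using poly3_mult[OF poly3_inner Suc] by simp
qed

lemma poly3_poly_inner:
  assumes "degree f \<le> d"
  shows "poly3_deg_le d (\<lambda>x. poly f (x \<bullet> \<eta>))"
proof -
  have "poly3_deg_le d (\<lambda>x. coeff f n * (x \<bullet> \<eta>) ^ n)" if "n \<le> degree f" for n
  proof -
    \<comment> \<open>The constant gets the slack d - n as its degree bound, so that the product
      with the n-th power has bound d.\<close>
    have "poly3_deg_le (d - n) (\<lambda>x. coeff f n)" using poly3_monomial[of 0 0 0 "d - n" "coeff f n"] by simp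
    from poly3_mult[OF this poly3_power_inner[of n \<eta>]] show ?thesis using that assms by simp
  qed
  then show ?thesis unfolding poly_altdef by (intro poly3_sum) simp
qed

section \<open>Discrete orthogonality on the nodes and the error estimate\<close>

lemma sphere_integral_scale:
  "sphere_integral r f = r\<^sup>2 * sphere_integral 1 (\<lambda>x. f (r *\<^sub>R x))"
proof -
  have sc: "r *\<^sub>R sph 1 \<theta> \<phi> = sph r \<theta> \<phi>" for \<theta> \<phi>
    by (simp add: sph_def vec_eq_iff forall_3)
  have "sphere_integral r f = integral (cbox (0,0) (pi, 2*pi))
      (\<lambda>t. r\<^sup>2 * (case t of (\<theta>,\<phi>) \<Rightarrow> f (r *\<^sub>R sph 1 \<theta> \<phi>) * 1\<^sup>2 * sin \<theta>))"
    unfolding sphere_integral_def sc by (simp add: case_prod_unfold mult_ac)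
  also have "\<dots> = r\<^sup>2 * sphere_integral 1 (\<lambda>x. f (r *\<^sub>R x))"
    unfolding sphere_integral_def by (rule integral_mult_right)
  finally show ?thesis .
qed

text \<open>The product has degree at most 2c, so the quadrature is exact for it and the nodes
  inherit the integral formula of \<open>pair_integral_legendre\<close>.\<close>

lemma quadrature_legendre:
  fixes Y :: "(real^3) set"
  assumes r: "r > 0" and Y: "finite Y" "Y \<noteq> {}"
    and quad: "\<And>p. poly3_deg_le (2*c) p \<Longrightarrow> sphere_integral r p = 4 * pi * r\<^sup>2 / card Y * (\<Sum>y\<in>Y. p y)"
    and lm: "l \<le> c" "m \<le> c" and unit: "norm \<eta> = 1" "norm \<zeta> = 1"
  shows "(\<Sum>y\<in>Y. poly (legendre l) (\<eta> \<bullet> (y /\<^sub>R r)) * poly (legendre m) (\<zeta> \<bullet> (y /\<^sub>R r))) =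
      real (card Y) * (if l = m then poly (legendre l) (\<eta> \<bullet> \<zeta>) / (2 * real l + 1) else 0)"
proof -
  \<comment> \<open>The scaling by 1/r is put on the axes, which shows p as a polynomial in the
    unscaled point y.\<close>
  define p where "p y = poly (legendre l) (y \<bullet> (\<eta> /\<^sub>R r)) * poly (legendre m) (y \<bullet> (\<zeta> /\<^sub>R r))" for y
  have "poly3_deg_le (c + c) p"
    unfolding p_def
    by (intro poly3_mult poly3_poly_inner order.trans[OF degree_legendre_le] lm)
  then have "sphere_integral r p = 4 * pi * r\<^sup>2 / card Y * (\<Sum>y\<in>Y. p y)"
    by (intro quad) (simp add: mult_2)
  moreover have "sphere_integral r p = r\<^sup>2 * pair_integral (legendre l) (legendre m) \<eta> \<zeta>"
    unfolding sphere_integral_scale[of r] p_def pair_integral_def using r by (simp flip: mult.assoc)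
  ultimately have "r\<^sup>2 * pair_integral (legendre l) (legendre m) \<eta> \<zeta> = r\<^sup>2 * (4 * pi / card Y * (\<Sum>y\<in>Y. p y))"
    by simp
  then have "pair_integral (legendre l) (legendre m) \<eta> \<zeta> = 4 * pi / card Y * (\<Sum>y\<in>Y. p y)"
    by (rule mult_left_cancel[THEN iffD1, rotated]) (use r in simp)
  then have "(\<Sum>y\<in>Y. p y) = card Y * (pair_integral (legendre l) (legendre m) \<eta> \<zeta> / (4 * pi))"
    using Y by simp
  moreover have "p y = poly (legendre l) (\<eta> \<bullet> (y /\<^sub>R r)) * poly (legendre m) (\<zeta> \<bullet> (y /\<^sub>R r))" for y
    by (simp add: p_def inner_commute)
  ultimately show ?thesis using pair_integral_legendre[OF unit, of l m] by simp
qed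

text \<open>At x = 0 any unit vector serves, so a source at the origin needs no separate
  treatment.\<close>

lemma unit_direction:
  fixes x :: "real^3"
  obtains \<eta> where "norm \<eta> = 1" "x = norm x *\<^sub>R \<eta>"
proof (cases "x = 0")
  case True
  then show thesis using that[of "axis 1 1"] by simp
next
  case False
  then show thesis using that[of "x /\<^sub>R norm x"] by simp
qed

text \<open>Truncation at degree c changes the potential by at most \<open>\<tau>\<close> wherever
  the norm is at least r2. The tail is paid for once at \<open>y0\<close> and, multiplied by c+1,
  once on the nodes, which gives the factor c+2.\<close>

lemma potential_bound:
  fixes I :: "'i set" and Y :: "(real^3) set" and p :: "'i \<Rightarrow> real^3" and w :: "'i \<Rightarrow> real"
  defines "e \<equiv> \<lambda>y. \<Sum>j\<in>I. w j * kernel (p j) y"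
  assumes r: "0 < r1" "r1 < r2" and Y: "finite Y" "Y \<noteq> {}" "Y \<subseteq> sphere 0 r2"
    and quad: "\<And>p. poly3_deg_le (2*c) p \<Longrightarrow> sphere_integral r2 p = 4 * pi * r2\<^sup>2 / card Y * (\<Sum>y\<in>Y. p y)"
    and p: "\<And>j. j \<in> I \<Longrightarrow> norm (p j) \<le> r1"
    and y0: "r2 \<le> norm y0"
  shows "\<bar>e y0\<bar> \<le> (real c + 1) * (L2_set e Y / sqrt (card Y))
    + (real c + 2) * ((\<Sum>j\<in>I. \<bar>w j\<bar>) * ((r1 / r2) ^ (c + 1) / (r2 - r1)))"
proof -
  define \<tau> where "\<tau> = (\<Sum>j\<in>I. \<bar>w j\<bar>) * ((r1 / r2) ^ (c + 1) / (r2 - r1))"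
  have "\<tau> \<ge> 0" unfolding \<tau>_def using r by (intro mult_nonneg_nonneg sum_nonneg) auto
  have "\<exists>\<eta>. norm \<eta> = 1 \<and> x = norm x *\<^sub>R \<eta>" for x :: "real^3" using unit_direction by blast
  then obtain dir :: "real^3 \<Rightarrow> real^3" where dir: "\<And>x. norm (dir x) = 1" "\<And>x. x = norm x *\<^sub>R dir x"
    by metis
  define a where "a j = norm (p j)" for j
  define \<eta> where "\<eta> j = dir (p j)" for j
  define ec where "ec y = (\<Sum>j\<in>I. \<Sum>l\<le>c. w j * (a j ^ l / norm y ^ (l + 1)) * poly (legendre l) (\<eta> j \<bullet> dir y))" for y
  have tail: "\<bar>e y - ec y\<bar> \<le> \<tau>" if "r2 \<le> norm y" for y
  proof -
    have "\<bar>e y - ec y\<bar> = \<bar>\<Sum>j\<in>I. w j * (kernel (p j) y -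
        (\<Sum>l\<le>c. a j ^ l / norm y ^ (l + 1) * poly (legendre l) (\<eta> j \<bullet> dir y)))\<bar>"
      unfolding e_def ec_def by (simp add: sum_subtractf right_diff_distrib sum_distrib_left mult.assoc)
    also have "\<dots> \<le> (\<Sum>j\<in>I. \<bar>w j\<bar> * ((r1 / r2) ^ (c + 1) / (r2 - r1)))"
    proof (rule order.trans[OF sum_abs], rule sum_mono)
      fix j assume j: "j \<in> I"
      have "\<bar>kernel (a j *\<^sub>R \<eta> j) (norm y *\<^sub>R dir y) -
          (\<Sum>l\<le>c. a j ^ l / norm y ^ (l + 1) * poly (legendre l) (\<eta> j \<bullet> dir y))\<bar> \<le> (r1 / r2) ^ (c + 1) / (r2 - r1)"
        by (rule kernel_tail_bound) (use p[OF j] r that in \<open>auto simp: a_def \<eta>_def dir(1)\<close>)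
      then show "\<bar>w j * (kernel (p j) y - (\<Sum>l\<le>c. a j ^ l / norm y ^ (l + 1) * poly (legendre l) (\<eta> j \<bullet> dir y)))\<bar>
          \<le> \<bar>w j\<bar> * ((r1 / r2) ^ (c + 1) / (r2 - r1))"
        using dir(2)[of y] dir(2)[of "p j"] unfolding abs_mult a_def \<eta>_def
        by (intro mult_left_mono) auto
    qed
    finally show ?thesis unfolding \<tau>_def sum_distrib_right .
  qed
  have normY: "norm y = r2" if "y \<in> Y" for y using that Y by auto
  have dirY: "dir y = y /\<^sub>R r2" if "y \<in> Y" for y
    using normY[OF that] dir(2)[of y] r by (metis divideR_right less_irrefl order.strict_trans)
  \<comment> \<open>Moving from radius r2 out to the radius of \<open>y0\<close> multiplies the
    degree-l part by t^(l+1).\<close>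
  define t where "t = r2 / norm y0"
  have t: "0 \<le> t" "t \<le> 1" using y0 r by (auto simp: t_def divide_le_eq)
  have "\<bar>\<Sum>j\<in>I. \<Sum>l\<le>c. (w j * (a j ^ l / r2 ^ (l + 1))) * t ^ (l + 1) * poly (legendre l) (\<eta> j \<bullet> dir y0)\<bar> \<le>
      (real c + 1) * (L2_set (\<lambda>y. \<Sum>j\<in>I. \<Sum>l\<le>c. (w j * (a j ^ l / r2 ^ (l + 1))) *
        poly (legendre l) (\<eta> j \<bullet> (y /\<^sub>R r2))) Y / sqrt (card Y))"
    by (rule reproducing_bound[OF Y(1,2) quadrature_legendre[OF _ Y(1,2) quad] t dir(1)])
      (use r in \<open>simp_all add: dir(1) \<eta>_def\<close>)
  moreover have "(\<Sum>j\<in>I. \<Sum>l\<le>c. (w j * (a j ^ l / r2 ^ (l + 1))) * t ^ (l + 1) * poly (legendre l) (\<eta> j \<bullet> dir y0)) = ec y0"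
    unfolding ec_def using r by (intro sum.cong refl) (simp add: t_def power_divide)
  moreover have "L2_set (\<lambda>y. \<Sum>j\<in>I. \<Sum>l\<le>c. (w j * (a j ^ l / r2 ^ (l + 1))) *
        poly (legendre l) (\<eta> j \<bullet> (y /\<^sub>R r2))) Y = L2_set ec Y"
    by (intro L2_set_cong refl) (simp add: ec_def normY dirY)
  ultimately have main: "\<bar>ec y0\<bar> \<le> (real c + 1) * (L2_set ec Y / sqrt (card Y))" by simp
  have N: "sqrt (card Y) > 0" using Y by (simp add: card_gt_0_iff)
  have "L2_set ec Y = L2_set (\<lambda>y. e y + (ec y - e y)) Y" by simp
  also have "\<dots> \<le> L2_set e Y + L2_set (\<lambda>y. ec y - e y) Y" by (rule L2_set_triangle_ineq)
  also have "L2_set (\<lambda>y. ec y - e y) Y \<le> sqrt (\<Sum>y\<in>Y. \<tau>\<^sup>2)"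
    unfolding L2_set_def
    by (intro real_sqrt_le_mono sum_mono, subst abs_le_square_iff[symmetric])
      (use tail normY \<open>\<tau> \<ge> 0\<close> in \<open>simp add: abs_minus_commute\<close>)
  also have "\<dots> = sqrt (card Y) * \<tau>" using \<open>\<tau> \<ge> 0\<close> by (simp add: real_sqrt_mult)
  finally have "L2_set ec Y / sqrt (card Y) \<le> L2_set e Y / sqrt (card Y) + \<tau>"
    using N by (simp add: field_simps)
  then have "\<bar>ec y0\<bar> \<le> (real c + 1) * (L2_set e Y / sqrt (card Y) + \<tau>)"
    by (intro order.trans[OF main] mult_left_mono) auto
  with tail[OF y0] have "\<bar>e y0\<bar> \<le> (real c + 1) * (L2_set e Y / sqrt (card Y) + \<tau>) + \<tau>" by linarith
  then show ?thesis unfolding \<tau>_def[symmetric] by (simp add: algebra_simps)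
qed

lemma sum_abs_le_row_maxnorm: "(\<Sum>j<k. \<bar>U i j\<bar>) \<le> k * row_maxnorm U k i"
proof -
  have "\<bar>U i j\<bar> \<le> row_maxnorm U k i" if "j < k" for j
    unfolding row_maxnorm_def using that by (intro Max_ge) auto
  then have "(\<Sum>j<k. \<bar>U i j\<bar>) \<le> (\<Sum>j<k. row_maxnorm U k i)" by (intro sum_mono) auto
  then show ?thesis by simp
qed

lemma l2_on_le:
  assumes "finite Z" "Z \<noteq> {}" and f: "\<And>z. z \<in> Z \<Longrightarrow> \<bar>f z\<bar> \<le> B"
  shows "l2_on f Z / sqrt (card Z) \<le> B"
proof -
  obtain z where "z \<in> Z" using assms by blast
  then have B: "B \<ge> 0" using f abs_ge_zero order.trans by blast
  have "(\<Sum>z\<in>Z. (f z)\<^sup>2) \<le> (\<Sum>z\<in>Z. B\<^sup>2)"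
    using f B by (intro sum_mono) (simp add: abs_le_square_iff[symmetric])
  then have "l2_on f Z \<le> sqrt (\<Sum>z\<in>Z. B\<^sup>2)"
    unfolding l2_on_def by (rule real_sqrt_le_mono)
  also have "\<dots> = sqrt (card Z) * B" using B by (simp add: real_sqrt_mult)
  finally show ?thesis using assms by (simp add: divide_le_eq card_gt_0_iff mult.commute)
qed

theorem theorem1:
  fixes r1 r2 :: real and n k c :: nat
    and x xr :: "nat \<Rightarrow> real^3" and U :: "nat \<Rightarrow> nat \<Rightarrow> real"
    and Yp Y0 :: "(real^3) set"
  assumes r: "0 < r1" "r1 < r2"
    and X0: "inj_on x {..<n}" "\<forall>i<n. x i \<in> ball 0 r1"
    and Xrep: "inj_on xr {..<k}" "xr ` {..<k} \<subseteq> x ` {..<n}"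
    and Yp: "finite Yp" "Yp \<noteq> {}" "Yp \<subseteq> sphere 0 r2"
    and quad: "\<forall>p. poly3_deg_le (2*c) p \<longrightarrow>
                 sphere_integral r2 p = 4 * pi * r2\<^sup>2 / card Yp * (\<Sum>y\<in>Yp. p y)"
    and Y0: "finite Y0" "Y0 \<noteq> {}" "Y0 \<subseteq> - ball 0 r2"
  shows "(\<forall>i<n. l2_on (err x xr k U i) Y0 / sqrt (card Y0)
            \<le> (c+1) * (l2_on (err x xr k U i) Yp / sqrt (card Yp))
               + (c+2) * (1 + k * row_maxnorm U k i) / (r2 - r1) * (r1 / r2) ^ (c+1))
      \<and> (\<forall>\<epsilon>::real>0. (\<forall>i<n. l2_on (err x xr k U i) Yp \<le> \<epsilon> * sqrt (card Yp)) \<longrightarrow>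
           (\<forall>i<n. l2_on (err x xr k U i) Y0 / sqrt (card Y0)
              \<le> (c+1) * \<epsilon>
                 + (c+2) * (1 + k * row_maxnorm U k i) / (r2 - r1) * (r1 / r2) ^ (c+1)))"
proof -
  define q where "q = (r1 / r2) ^ (c + 1) / (r2 - r1)"
  have "q \<ge> 0" using r by (simp add: q_def)
  have main: "l2_on (err x xr k U i) Y0 / sqrt (card Y0)
            \<le> (c+1) * (l2_on (err x xr k U i) Yp / sqrt (card Yp))
               + (c+2) * (1 + k * row_maxnorm U k i) / (r2 - r1) * (r1 / r2) ^ (c+1)"
    (is "?L \<le> ?B") if i: "i < n" for i
  proof -
    \<comment> \<open>The error is written as one potential of k+1 sources: the representatives with
      weights -U_ij and, at index k, the point x_i with weight 1. The total weight then gives the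
      factor 1 + k times the row norm.\<close>
    define p where "p j = (if j < k then xr j else x i)" for j
    define w where "w j = (if j < k then - U i j else 1)" for j
    have err: "err x xr k U i = (\<lambda>y. \<Sum>j\<le>k. w j * kernel (p j) y)"
      by (rule ext) (simp add: err_def p_def w_def sum_negf flip: lessThan_Suc_atMost)
    have W: "(\<Sum>j\<le>k. \<bar>w j\<bar>) \<le> 1 + k * row_maxnorm U k i"
      using sum_abs_le_row_maxnorm[where U = U and i = i and k = k]
      by (simp add: w_def flip: lessThan_Suc_atMost)
    have p: "norm (p j) \<le> r1" if "j \<in> {..k}" for j
    proof (cases "j < k")
      case True
      then obtain i' where "i' < n" "xr j = x i'" using Xrep(2) by auto
      then show ?thesis using X0(2) True by (force simp: p_def)
    next
      case False
      then show ?thesis using X0(2) i by (force simp: p_def)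
    qed
    \<comment> \<open>A bound valid at every point outside the ball of radius r2 passes to the root
      mean square over any finite nonempty \<open>Y0\<close>.\<close>
    have pt: "\<bar>err x xr k U i y\<bar> \<le> ?B" if "y \<in> Y0" for y
    proof -
      have y: "r2 \<le> norm y" using that Y0(3) by (auto simp: not_less)
      have "\<bar>err x xr k U i y\<bar> \<le> (real c + 1) * (L2_set (err x xr k U i) Yp / sqrt (card Yp))
          + (real c + 2) * ((\<Sum>j\<le>k. \<bar>w j\<bar>) * q)"
        unfolding err q_def by (rule potential_bound[OF r Yp quad[rule_format] p y])
      also have "\<dots> \<le> (real c + 1) * (L2_set (err x xr k U i) Yp / sqrt (card Yp))
          + (real c + 2) * ((1 + k * row_maxnorm U k i) * q)"
        using W \<open>q \<ge> 0\<close> by (intro add_left_mono mult_left_mono mult_right_mono) auto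
      also have "\<dots> = ?B" by (simp add: q_def l2_on_def L2_set_def add.commute mult_ac)
      finally show ?thesis .
    qed
    then show ?thesis using Y0 by (intro l2_on_le)
  qed
  moreover have "l2_on (err x xr k U i) Y0 / sqrt (card Y0)
              \<le> (c+1) * \<epsilon>
                 + (c+2) * (1 + k * row_maxnorm U k i) / (r2 - r1) * (r1 / r2) ^ (c+1)"
    if "i < n" "\<forall>i<n. l2_on (err x xr k U i) Yp \<le> \<epsilon> * sqrt (card Yp)" for i and \<epsilon> :: real
  proof -
    have "l2_on (err x xr k U i) Yp / sqrt (card Yp) \<le> \<epsilon>"
      using that Yp by (simp add: divide_le_eq card_gt_0_iff)
    then have "(c+1) * (l2_on (err x xr k U i) Yp / sqrt (card Yp)) \<le> (c+1) * \<epsilon>"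
      by (rule mult_left_mono) simp
    then show ?thesis using main[OF that(1)] by linarith
  qed
  ultimately show ?thesis by blast
qed

end
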